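(* Let $\Lambda$ be a strongly connected finite $k$-graph, $(G,\Lambda)$ a finite-state self-similar groupoid action, $M$ the Parry measure on $\Lambda^\infty$, and $x_\Lambda$ the unimodular Perron–Frobenius eigenvector of $\Lambda$. For $\lambda,\mu\in\Lambda$ and $g\in G$ with $s(\lambda)=\operatorname{cod}(g)$ and $s(\mu)=\operatorname{dom}(g)$, let $$Z(\lambda,g,\mu)=\{x\in\Lambda^\infty: x=\lambda(g\cdot y)=\mu y\text{ for some }y\in\Lambda^\infty\}.$$ Then $M(Z(\lambda,g,\mu))$ equals (i) $\rho(\Lambda)^{-d(\mu)}x_\Lambda(s(\mu))$ if $d(\lambda)-d(\mu)\in\operatorname{Per}(G,\Lambda)$, $\mu=\theta_{d(\lambda),d(\mu)}(\lambda)$ and $g=h_{d(\lambda),d(\mu)}(\lambda)$; (ii) $\rho(\Lambda)^{-d(\mu)}c_{d(\lambda),d(\mu),\lambda}(g)$ if $d(\lambda)-d(\mu)\in\operatorname{Per}(G,\Lambda)$, $\mu=\theta_{d(\lambda),d(\mu)}(\lambda)$ and $g\ne h_{d(\lambda),d(\mu)}(\lambda)$; (iii) $0$ otherwise.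
   Context: Conventions: $\mathbb N=\{0,1,2,\dots\}$ and $e_1,\dots,e_k$ are the standard generators of $\mathbb N^k$ ($k\ge1$). A $k$-graph is a countable small category $\Lambda$ with a degree functor $d:\Lambda\to\mathbb N^k$ such that whenever $d(\lambda)=p+q$ there are unique $\mu,\nu$ with $\lambda=\mu\nu$, $d(\mu)=p$, $d(\nu)=q$. Write $\Lambda^p=d^{-1}(p)$; $\Lambda^0$ is identified with the set of objects (vertices); $r,s:\Lambda\to\Lambda^0$ are the codomain and domain maps, so $\lambda\mu$ is defined iff $s(\lambda)=r(\mu)$. An edge is an element of some $\Lambda^{e_i}$. $v\Lambda=r^{-1}(v)$, $\Lambda v=s^{-1}(v)$, $v\Lambda^p=v\Lambda\cap\Lambda^p$, $v\Lambda^pw=v\Lambda^p\cap\Lambda w$. $\Lambda$ is finite if every $\Lambda^p$ is finite; it is strongly connected if $v\Lambda w\ne\emptyset$ for all $v,w\in\Lambda^0$; as usual $\Lambda^{e_i}\neq\emptyset$ for each $i$. Self-similar actions: For a groupoid $G$, $\operatorname{dom},\operatorname{cod}$ are the source and range maps, and $gh$ is defined iff $\operatorname{dom}(g)=\operatorname{cod}(h)$. A partial isomorphism of $\Lambda$ consists of $v,w\in\Lambda^0$ and a bijection $g:v\Lambda\to w\Lambda$ with $g(v\Lambda^p)=w\Lambda^p$ for all $p$, and $g(\lambda e)\in g(\lambda)\Lambda$ for all $\lambda\in v\Lambda$ and edges $e\in s(\lambda)\Lambda$; put $\operatorname{dom}(g)=v$, $\operatorname{cod}(g)=w$. These form a groupoid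 $\operatorname{PIso}(\Lambda)$ under composition, with unit space $\Lambda^0$ ($v$ identified with $\mathrm{id}_{v\Lambda}$). An action of a groupoid $G$ with unit space $\Lambda^0$ on $\Lambda$ is a (unit-preserving) groupoid homomorphism $G\to\operatorname{PIso}(\Lambda)$, written $g\cdot\mu$; it is faithful if injective. A self-similar groupoid action $(G,\Lambda)$ is a faithful action such that for every $g\in G$ and edge $e\in\operatorname{dom}(g)\Lambda$ there is $h\in G$ with $g\cdot(e\lambda)=(g\cdot e)(h\cdot\lambda)$ for all $\lambda\in s(e)\Lambda$; this $h$ is unique and written $g|_e$. For $\lambda\in\operatorname{dom}(g)\Lambda$, factored into edges as $\lambda_1\cdots\lambda_l$, put $g|_\lambda=(\cdots(g|_{\lambda_1})|_{\lambda_2}\cdots)|_{\lambda_l}$ (independent of the factorisation; $g|_{\operatorname{dom}(g)}=g$), so $g\cdot(\lambda\mu)=(g\cdot\lambda)(g|_\lambda\cdot\mu)$. The action is finite-state if for every $g\in G\setminus\Lambda^0$ the set $\{g|_\lambda:\lambda\in\operatorname{dom}(g)\Lambda\}$ is finite. Perron–Frobenius data: $B_i(v,w)=|v\Lambda^{e_i}w|$, $\rho(B_i)$ is the spectral radius (it is positive), $\rho(\Lambda)^n=\prod_i\rho(B_i)^{n_i}$ for $n\in\mathbb Z^k$. The unimodular Perron–Frobenius eigenvector $x_\Lambda\in(0,\infty)^{\Lambda^0}$ is the unique vector with unit $1$-norm and $B_ix_\Lambda=\rho(B_i)x_\Lambda$ for all $i$. Infinite paths and Parry measure: $\Lambda^\infty$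 is the set of degree-preserving functors $x:\Omega_k\to\Lambda$, where $\Omega_k=\{(p,q)\in\mathbb N^k\times\mathbb N^k:p\le q\}$ with $(p,q)(q,n)=(p,n)$, $d(p,q)=q-p$; $r(x)=x(0,0)$, $v\Lambda^\infty=\{x:r(x)=v\}$, $\sigma^n(x)(p,q)=x(p+n,q+n)$; for $\lambda\in\Lambda$, $y\in s(\lambda)\Lambda^\infty$, $\lambda y$ is the concatenation. $G$ acts on $\Lambda^\infty$ by $(g\cdot x)(p,q)=g|_{x(0,p)}\cdot x(p,q)$ for $x\in\operatorname{dom}(g)\Lambda^\infty$. $\Lambda^\infty$ has the topology with basis $Z(\lambda)=\{\lambda y:y\in s(\lambda)\Lambda^\infty\}$, $\lambda\in\Lambda$. The Parry measure $M$ is the unique Borel probability measure on $\Lambda^\infty$ with $M(Z(\lambda))=\rho(\Lambda)^{-d(\lambda)}M(Z(s(\lambda)))=\rho(\Lambda)^{-d(\lambda)}x_\Lambda(s(\lambda))$ for all $\lambda\in\Lambda$. The sets $Z(\lambda,g,\mu)$ are closed. Periodicity: $\operatorname{Per}(G,\Lambda)$ is the set of $p-q$ ($p,q\in\mathbb N^k$) for which there is $g\in G$ with $\sigma^p(x)=\sigma^q(g\cdot x)$ for all $x\in\operatorname{dom}(g)\Lambda^\infty$; it is a subgroup of $\mathbb Z^k$. For $p,q\in\mathbb N^k$ with $p-q\in\operatorname{Per}(G,\Lambda)$ and $\lambda\in\Lambda^p$, $(\theta_{p,q}(\lambda),h_{p,q}(\lambda))$ denotes the unique pair in $\Lambda^q\times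 G$ with $\operatorname{cod}(h_{p,q}(\lambda))=s(\lambda)$, $\operatorname{dom}(h_{p,q}(\lambda))=s(\theta_{p,q}(\lambda))$ and $\lambda(h_{p,q}(\lambda)\cdot x)=\theta_{p,q}(\lambda)x$ for all $x\in\operatorname{dom}(h_{p,q}(\lambda))\Lambda^\infty$. With $N=(1,\dots,1)\in\mathbb N^k$, for $g\in G$ with $g\neq h_{p,q}(\lambda)$, $\operatorname{cod}(g)=\operatorname{cod}(h_{p,q}(\lambda))$, $\operatorname{dom}(g)=\operatorname{dom}(h_{p,q}(\lambda))$, put $$c_{p,q,\lambda}(g)=\lim_{l\to\infty}\rho(\Lambda)^{-lN}\sum_{v\in\Lambda^0}\big|\{\mu\in\operatorname{dom}(g)\Lambda^{lN}v:g\cdot\mu=h_{p,q}(\lambda)\cdot\mu,\ g|_\mu=h_{p,q}(\lambda)|_\mu\}\big|\,x_\Lambda(v)$$ (the limit exists). *)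

theory Defs
  imports
    "HOL-Analysis.Analysis"
    "HOL-Library.Function_Algebras"
    "Jordan_Normal_Form.Spectral_Radius"
begin

text \<open>
  The composite \<open>a \<cdot>\<^bsub>C\<^esub> b\<close> is meaningful iff \<open>Dom C a = Cod C b\<close>. For a \<open>k\<close>-graph, \<open>Cod\<close> and
  \<open>Dom\<close> are the maps \<open>r\<close> and \<open>s\<close>.
\<close>

record ('o, 'm) category =
  Obj :: "'o set"
  Arr :: "'m set"
  Dom :: "'m \<Rightarrow> 'o"
  Cod :: "'m \<Rightarrow> 'o"
  Ide :: "'o \<Rightarrow> 'm"
  Comp :: "'m \<Rightarrow> 'm \<Rightarrow> 'm"  (infixl "\<cdot>\<index>" 70)

locale category =
  fixes C :: "('o, 'm, 'z) category_scheme" (structure)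
  assumes Dom_closed: "a \<in> Arr C \<Longrightarrow> Dom C a \<in> Obj C"
    and Cod_closed: "a \<in> Arr C \<Longrightarrow> Cod C a \<in> Obj C"
    and Ide_closed: "v \<in> Obj C \<Longrightarrow> Ide C v \<in> Arr C"
    and Dom_Ide: "v \<in> Obj C \<Longrightarrow> Dom C (Ide C v) = v"
    and Cod_Ide: "v \<in> Obj C \<Longrightarrow> Cod C (Ide C v) = v"
    and Comp_closed: "\<lbrakk>a \<in> Arr C; b \<in> Arr C; Dom C a = Cod C b\<rbrakk> \<Longrightarrow> a \<cdot> b \<in> Arr C"
    and Dom_Comp: "\<lbrakk>a \<in> Arr C; b \<in> Arr C; Dom C a = Cod C b\<rbrakk> \<Longrightarrow> Dom C (a \<cdot> b) = Dom C b"
    and Cod_Comp: "\<lbrakk>a \<in> Arr C; b \<in> Arr C; Dom C a = Cod C b\<rbrakk> \<Longrightarrow> Cod C (a \<cdot> b) = Cod C a"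
    and Ide_Comp: "a \<in> Arr C \<Longrightarrow> Ide C (Cod C a) \<cdot> a = a"
    and Comp_Ide: "a \<in> Arr C \<Longrightarrow> a \<cdot> Ide C (Dom C a) = a"
    and Comp_assoc:
      "\<lbrakk>a \<in> Arr C; b \<in> Arr C; c \<in> Arr C; Dom C a = Cod C b; Dom C b = Cod C c\<rbrakk>
        \<Longrightarrow> (a \<cdot> b) \<cdot> c = a \<cdot> (b \<cdot> c)"

locale groupoid = category +
  assumes invertible:
    "a \<in> Arr C \<Longrightarrow> \<exists>b \<in> Arr C. Dom C b = Cod C a \<and> Cod C b = Dom C a \<and>
      a \<cdot> b = Ide C (Cod C a) \<and> b \<cdot> a = Ide C (Dom C a)"

definition is_functor ::
  "('o, 'm, 'z) category_scheme \<Rightarrow> ('p, 'n, 'y) category_scheme \<Rightarrow> ('o \<Rightarrow> 'p) \<Rightarrow> ('m \<Rightarrow> 'n) \<Rightarrow> bool"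
where
  "is_functor C D F0 F \<longleftrightarrow>
    F0 \<in> Obj C \<rightarrow> Obj D \<and> F \<in> Arr C \<rightarrow> Arr D \<and>
    (\<forall>a \<in> Arr C. Dom D (F a) = F0 (Dom C a) \<and> Cod D (F a) = F0 (Cod C a)) \<and>
    (\<forall>v \<in> Obj C. F (Ide C v) = Ide D (F0 v)) \<and>
    (\<forall>a \<in> Arr C. \<forall>b \<in> Arr C. Dom C a = Cod C b \<longrightarrow> F (a \<cdot>\<^bsub>C\<^esub> b) = F a \<cdot>\<^bsub>D\<^esub> F b)"


section \<open>\<open>k\<close>-graphs\<close>

text \<open>
  \<open>\<nat>\<^sup>k\<close> is the type \<open>'k \<Rightarrow> nat\<close> with \<open>'k\<close> finite and pointwise addition and order. The vertex set
  \<open>\<Lambda>\<^sup>0\<close> is \<open>Obj \<Lambda>\<close>; the vertex \<open>v\<close>, viewed as a path, is \<open>Ide \<Lambda> v\<close>.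
\<close>

record ('v, 'a, 'k) kgraph = "('v, 'a) category" +
  deg :: "'a \<Rightarrow> 'k \<Rightarrow> nat"

definition unit_deg :: "'k \<Rightarrow> 'k \<Rightarrow> nat" where
  "unit_deg i = (\<lambda>j. if j = i then 1 else 0)"

locale k_graph = category \<Lambda> for \<Lambda> :: "('v, 'a, 'k::finite) kgraph" (structure) +
  assumes countable_Arr: "countable (Arr \<Lambda>)"
    and deg_Ide: "v \<in> Obj \<Lambda> \<Longrightarrow> deg \<Lambda> (Ide \<Lambda> v) = 0"
    and deg_Comp: "\<lbrakk>a \<in> Arr \<Lambda>; b \<in> Arr \<Lambda>; Dom \<Lambda> a = Cod \<Lambda> b\<rbrakk>
      \<Longrightarrow> deg \<Lambda> (a \<cdot> b) = deg \<Lambda> a + deg \<Lambda> b"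
    and unique_factorisation: "\<lbrakk>l \<in> Arr \<Lambda>; deg \<Lambda> l = p + q\<rbrakk>
      \<Longrightarrow> \<exists>!(m, n). m \<in> Arr \<Lambda> \<and> n \<in> Arr \<Lambda> \<and> Dom \<Lambda> m = Cod \<Lambda> n \<and>
            l = m \<cdot> n \<and> deg \<Lambda> m = p \<and> deg \<Lambda> n = q"

definition paths_of_deg :: "('v, 'a, 'k) kgraph \<Rightarrow> ('k \<Rightarrow> nat) \<Rightarrow> 'a set" where
  "paths_of_deg \<Lambda> p = {l \<in> Arr \<Lambda>. deg \<Lambda> l = p}"

definition edges :: "('v, 'a, 'k) kgraph \<Rightarrow> 'a set" where
  "edges \<Lambda> = (\<Union>i. paths_of_deg \<Lambda> (unit_deg i))"

definition paths_to :: "('v, 'a, 'k) kgraph \<Rightarrow> 'v \<Rightarrow> 'a set" where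
  "paths_to \<Lambda> v = {l \<in> Arr \<Lambda>. Cod \<Lambda> l = v}"

definition paths_from :: "('v, 'a, 'k) kgraph \<Rightarrow> 'v \<Rightarrow> 'a set" where
  "paths_from \<Lambda> v = {l \<in> Arr \<Lambda>. Dom \<Lambda> l = v}"

text \<open>The set \<open>\<lambda>\<Lambda>\<close> of all extensions of a path \<open>\<lambda>\<close>.\<close>

definition extensions :: "('v, 'a, 'k) kgraph \<Rightarrow> 'a \<Rightarrow> 'a set" where
  "extensions \<Lambda> l = {l \<cdot>\<^bsub>\<Lambda>\<^esub> m | m. m \<in> paths_to \<Lambda> (Dom \<Lambda> l)}"

definition finite_kgraph :: "('v, 'a, 'k) kgraph \<Rightarrow> bool" where
  "finite_kgraph \<Lambda> \<longleftrightarrow> (\<forall>p. finite (paths_of_deg \<Lambda> p))"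

definition strongly_connected :: "('v, 'a, 'k) kgraph \<Rightarrow> bool" where
  "strongly_connected \<Lambda> \<longleftrightarrow>
    (\<forall>v \<in> Obj \<Lambda>. \<forall>w \<in> Obj \<Lambda>. paths_to \<Lambda> v \<inter> paths_from \<Lambda> w \<noteq> {})"

text \<open>The non-emptiness of each \<open>\<Lambda>\<^bsup>e\<^sub>i\<^esup>\<close> is a standing convention for \<open>k\<close>-graphs.\<close>

locale strongly_connected_finite_kgraph = k_graph +
  assumes finite_graph: "finite_kgraph \<Lambda>"
    and connected_graph: "strongly_connected \<Lambda>"
    and edges_nonempty: "paths_of_deg \<Lambda> (unit_deg i) \<noteq> {}"


section \<open>Self-similar groupoid actions\<close>

text \<open>
  A partial isomorphism with domain \<open>v\<close> and codomain \<open>w\<close> is the triple \<open>(v, w, g)\<close>, the map \<open>g\<close>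
  being made extensional on \<open>v\<Lambda>\<close> so that equality of triples is equality of partial isomorphisms.
\<close>

definition partial_iso :: "('v, 'a, 'k) kgraph \<Rightarrow> 'v \<Rightarrow> 'v \<Rightarrow> ('a \<Rightarrow> 'a) \<Rightarrow> bool" where
  "partial_iso \<Lambda> v w g \<longleftrightarrow>
    v \<in> Obj \<Lambda> \<and> w \<in> Obj \<Lambda> \<and> g \<in> extensional (paths_to \<Lambda> v) \<and>
    bij_betw g (paths_to \<Lambda> v) (paths_to \<Lambda> w) \<and>
    (\<forall>p. g ` (paths_to \<Lambda> v \<inter> paths_of_deg \<Lambda> p) = paths_to \<Lambda> w \<inter> paths_of_deg \<Lambda> p) \<and>
    (\<forall>l \<in> paths_to \<Lambda> v. \<forall>e \<in> edges \<Lambda> \<inter> paths_to \<Lambda> (Dom \<Lambda> l).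
      g (l \<cdot>\<^bsub>\<Lambda>\<^esub> e) \<in> extensions \<Lambda> (g l))"

definition PIso :: "('v, 'a, 'k) kgraph \<Rightarrow> ('v, 'v \<times> 'v \<times> ('a \<Rightarrow> 'a)) category" where
  "PIso \<Lambda> =
    \<lparr>Obj = Obj \<Lambda>,
     Arr = {(v, w, g). partial_iso \<Lambda> v w g},
     Dom = (\<lambda>(v, w, g). v),
     Cod = (\<lambda>(v, w, g). w),
     Ide = (\<lambda>v. (v, v, restrict id (paths_to \<Lambda> v))),
     Comp = (\<lambda>(v2, w2, g2) (v1, w1, g1). (v1, w2, compose (paths_to \<Lambda> v1) g2 g1))\<rparr>"

definition faithful_action ::
  "('v, 'g) category \<Rightarrow> ('v, 'a, 'k) kgraph \<Rightarrow> ('g \<Rightarrow> 'v \<times> 'v \<times> ('a \<Rightarrow> 'a)) \<Rightarrow> bool"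
where
  "faithful_action G \<Lambda> \<phi> \<longleftrightarrow>
    groupoid G \<and> Obj G = Obj \<Lambda> \<and> is_functor G (PIso \<Lambda>) (\<lambda>v. v) \<phi> \<and> inj_on \<phi> (Arr G)"

definition act :: "('g \<Rightarrow> 'v \<times> 'v \<times> ('a \<Rightarrow> 'a)) \<Rightarrow> 'g \<Rightarrow> 'a \<Rightarrow> 'a" where
  "act \<phi> g l = snd (snd (\<phi> g)) l"

text \<open>
  The conditions on \<open>Dom G h\<close> and \<open>Cod G h\<close> say that \<open>h \<cdot> \<lambda>\<close> and the composite on the right-hand
  side are defined.
\<close>

definition is_edge_restriction ::
  "('v, 'g) category \<Rightarrow> ('v, 'a, 'k) kgraph \<Rightarrow> ('g \<Rightarrow> 'v \<times> 'v \<times> ('a \<Rightarrow> 'a)) \<Rightarrow>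
    'g \<Rightarrow> 'a \<Rightarrow> 'g \<Rightarrow> bool"
where
  "is_edge_restriction G \<Lambda> \<phi> g e h \<longleftrightarrow>
    h \<in> Arr G \<and> Dom G h = Dom \<Lambda> e \<and> Cod G h = Dom \<Lambda> (act \<phi> g e) \<and>
    (\<forall>l \<in> paths_to \<Lambda> (Dom \<Lambda> e). act \<phi> g (e \<cdot>\<^bsub>\<Lambda>\<^esub> l) = act \<phi> g e \<cdot>\<^bsub>\<Lambda>\<^esub> act \<phi> h l)"

definition self_similar_action ::
  "('v, 'g) category \<Rightarrow> ('v, 'a, 'k) kgraph \<Rightarrow> ('g \<Rightarrow> 'v \<times> 'v \<times> ('a \<Rightarrow> 'a)) \<Rightarrow> bool"
where
  "self_similar_action G \<Lambda> \<phi> \<longleftrightarrow>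
    faithful_action G \<Lambda> \<phi> \<and>
    (\<forall>g \<in> Arr G. \<forall>e \<in> edges \<Lambda> \<inter> paths_to \<Lambda> (Dom G g). \<exists>h. is_edge_restriction G \<Lambda> \<phi> g e h)"

definition edge_restriction ::
  "('v, 'g) category \<Rightarrow> ('v, 'a, 'k) kgraph \<Rightarrow> ('g \<Rightarrow> 'v \<times> 'v \<times> ('a \<Rightarrow> 'a)) \<Rightarrow> 'g \<Rightarrow> 'a \<Rightarrow> 'g"
where
  "edge_restriction G \<Lambda> \<phi> g e = (THE h. is_edge_restriction G \<Lambda> \<phi> g e h)"

inductive edge_factorisation :: "('v, 'a, 'k) kgraph \<Rightarrow> 'a list \<Rightarrow> 'a \<Rightarrow> bool"
  for \<Lambda> :: "('v, 'a, 'k) kgraph"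
where
  Nil: "v \<in> Obj \<Lambda> \<Longrightarrow> edge_factorisation \<Lambda> [] (Ide \<Lambda> v)"
| Cons: "\<lbrakk>e \<in> edges \<Lambda>; edge_factorisation \<Lambda> es l; Dom \<Lambda> e = Cod \<Lambda> l\<rbrakk>
    \<Longrightarrow> edge_factorisation \<Lambda> (e # es) (e \<cdot>\<^bsub>\<Lambda>\<^esub> l)"

text \<open>
  A path has several factorisations into edges; \<open>THE\<close> uses that they all yield the same
  restriction.
\<close>

definition path_restriction ::
  "('v, 'g) category \<Rightarrow> ('v, 'a, 'k) kgraph \<Rightarrow> ('g \<Rightarrow> 'v \<times> 'v \<times> ('a \<Rightarrow> 'a)) \<Rightarrow> 'g \<Rightarrow> 'a \<Rightarrow> 'g"
where
  "path_restriction G \<Lambda> \<phi> g l =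
    (THE h. \<exists>es. edge_factorisation \<Lambda> es l \<and> h = foldl (edge_restriction G \<Lambda> \<phi>) g es)"

definition finite_state ::
  "('v, 'g) category \<Rightarrow> ('v, 'a, 'k) kgraph \<Rightarrow> ('g \<Rightarrow> 'v \<times> 'v \<times> ('a \<Rightarrow> 'a)) \<Rightarrow> bool"
where
  "finite_state G \<Lambda> \<phi> \<longleftrightarrow>
    (\<forall>g \<in> Arr G - Ide G ` Obj G. finite (path_restriction G \<Lambda> \<phi> g ` paths_to \<Lambda> (Dom G g)))"


section \<open>Perron--Frobenius data\<close>

definition edge_count :: "('v, 'a, 'k) kgraph \<Rightarrow> 'k \<Rightarrow> 'v \<Rightarrow> 'v \<Rightarrow> nat" where
  "edge_count \<Lambda> i v w = card (paths_to \<Lambda> v \<inter> paths_of_deg \<Lambda> (unit_deg i) \<inter> paths_from \<Lambda> w)"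

text \<open>
  The library's matrices are indexed by initial segments of the naturals, so \<open>\<Lambda>\<^sup>0\<close> is enumerated
  by \<open>from_nat_into\<close>; the spectral radius does not depend on the enumeration.
\<close>

definition edge_matrix :: "('v, 'a, 'k) kgraph \<Rightarrow> 'k \<Rightarrow> complex mat" where
  "edge_matrix \<Lambda> i = mat (card (Obj \<Lambda>)) (card (Obj \<Lambda>))
    (\<lambda>(a, b). of_nat (edge_count \<Lambda> i (from_nat_into (Obj \<Lambda>) a) (from_nat_into (Obj \<Lambda>) b)))"

definition rho :: "('v, 'a, 'k) kgraph \<Rightarrow> 'k \<Rightarrow> real" where
  "rho \<Lambda> i = spectral_radius (edge_matrix \<Lambda> i)"

definition rho_power :: "('v, 'a, 'k::finite) kgraph \<Rightarrow> ('k \<Rightarrow> int) \<Rightarrow> real" where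
  "rho_power \<Lambda> n = (\<Prod>i\<in>UNIV. rho \<Lambda> i powi n i)"

definition perron_frobenius_eigenvector :: "('v, 'a, 'k) kgraph \<Rightarrow> ('v \<Rightarrow> real) \<Rightarrow> bool" where
  "perron_frobenius_eigenvector \<Lambda> \<xi> \<longleftrightarrow>
    (\<forall>v \<in> Obj \<Lambda>. \<xi> v > 0) \<and> (\<Sum>v\<in>Obj \<Lambda>. \<bar>\<xi> v\<bar>) = 1 \<and>
    (\<forall>i. \<forall>v \<in> Obj \<Lambda>. (\<Sum>w\<in>Obj \<Lambda>. real (edge_count \<Lambda> i v w) * \<xi> w) = rho \<Lambda> i * \<xi> v)"


section \<open>Infinite paths and the Parry measure\<close>

definition Omega :: "('k \<Rightarrow> nat, ('k \<Rightarrow> nat) \<times> ('k \<Rightarrow> nat), 'k) kgraph" where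
  "Omega =
    \<lparr>Obj = UNIV,
     Arr = {(p, q). p \<le> q},
     Dom = snd,
     Cod = fst,
     Ide = (\<lambda>p. (p, p)),
     Comp = (\<lambda>a b. (fst a, snd b)),
     deg = (\<lambda>(p, q). q - p)\<rparr>"

type_synonym ('a, 'k) inf_path = "('k \<Rightarrow> nat) \<times> ('k \<Rightarrow> nat) \<Rightarrow> 'a"

text \<open>
  A functor out of \<open>\<Omega>\<^sub>k\<close> is represented by its arrow map, which determines the object map \<open>x0\<close>.
\<close>

definition inf_paths :: "('v, 'a, 'k) kgraph \<Rightarrow> ('a, 'k) inf_path set" where
  "inf_paths \<Lambda> =
    {x \<in> extensional (Arr Omega). (\<exists>x0. is_functor Omega \<Lambda> x0 x) \<and>
      (\<forall>a \<in> Arr Omega. deg \<Lambda> (x a) = deg Omega a)}"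

text \<open>The vertex \<open>r(x) = x(0,0)\<close>, the path \<open>x (0, 0)\<close> being an identity arrow.\<close>

definition inf_range :: "('v, 'a, 'k) kgraph \<Rightarrow> ('a, 'k) inf_path \<Rightarrow> 'v" where
  "inf_range \<Lambda> x = Cod \<Lambda> (x (0, 0))"

definition inf_paths_to :: "('v, 'a, 'k) kgraph \<Rightarrow> 'v \<Rightarrow> ('a, 'k) inf_path set" where
  "inf_paths_to \<Lambda> v = {x \<in> inf_paths \<Lambda>. inf_range \<Lambda> x = v}"

definition shift :: "('k \<Rightarrow> nat) \<Rightarrow> ('a, 'k) inf_path \<Rightarrow> ('a, 'k) inf_path" where
  "shift n x = (\<lambda>(p, q) \<in> Arr Omega. x (p + n, q + n))"

definition concat_inf ::
  "('v, 'a, 'k) kgraph \<Rightarrow> 'a \<Rightarrow> ('a, 'k) inf_path \<Rightarrow> ('a, 'k) inf_path"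
where
  "concat_inf \<Lambda> l y = (THE x. x \<in> inf_paths \<Lambda> \<and> x (0, deg \<Lambda> l) = l \<and> shift (deg \<Lambda> l) x = y)"

definition act_inf ::
  "('v, 'g) category \<Rightarrow> ('v, 'a, 'k) kgraph \<Rightarrow> ('g \<Rightarrow> 'v \<times> 'v \<times> ('a \<Rightarrow> 'a)) \<Rightarrow>
    'g \<Rightarrow> ('a, 'k) inf_path \<Rightarrow> ('a, 'k) inf_path"
where
  "act_inf G \<Lambda> \<phi> g x =
    (\<lambda>(p, q) \<in> Arr Omega. act \<phi> (path_restriction G \<Lambda> \<phi> g (x (0, p))) (x (p, q)))"

definition cylinder :: "('v, 'a, 'k) kgraph \<Rightarrow> 'a \<Rightarrow> ('a, 'k) inf_path set" where
  "cylinder \<Lambda> l = concat_inf \<Lambda> l ` inf_paths_to \<Lambda> (Dom \<Lambda> l)"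

text \<open>
  The cylinder sets form a basis of this topology, because the intersection of two of them is a
  union of cylinder sets.
\<close>

definition inf_path_topology :: "('v, 'a, 'k) kgraph \<Rightarrow> ('a, 'k) inf_path topology" where
  "inf_path_topology \<Lambda> = topology_generated_by {cylinder \<Lambda> l | l. l \<in> Arr \<Lambda>}"

definition parry_measure ::
  "('v, 'a, 'k::finite) kgraph \<Rightarrow> ('v \<Rightarrow> real) \<Rightarrow> ('a, 'k) inf_path measure \<Rightarrow> bool"
where
  "parry_measure \<Lambda> \<xi> M \<longleftrightarrow>
    space M = inf_paths \<Lambda> \<and>
    sets M = sigma_sets (inf_paths \<Lambda>) {U. openin (inf_path_topology \<Lambda>) U} \<and>
    emeasure M (space M) = 1 \<and>
    (\<forall>l \<in> Arr \<Lambda>.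
      measure M (cylinder \<Lambda> l)
        = rho_power \<Lambda> (\<lambda>i. - int (deg \<Lambda> l i)) * measure M (cylinder \<Lambda> (Ide \<Lambda> (Dom \<Lambda> l))) \<and>
      measure M (cylinder \<Lambda> l) = rho_power \<Lambda> (\<lambda>i. - int (deg \<Lambda> l i)) * \<xi> (Dom \<Lambda> l))"

text \<open>The set \<open>Z(\<lambda>, g, \<mu>)\<close>; \<open>g \<cdot> y\<close> requires \<open>y\<close> to lie in \<open>dom(g)\<Lambda>\<^sup>\<infinity>\<close>.\<close>

definition triple_cylinder ::
  "('v, 'g) category \<Rightarrow> ('v, 'a, 'k) kgraph \<Rightarrow> ('g \<Rightarrow> 'v \<times> 'v \<times> ('a \<Rightarrow> 'a)) \<Rightarrow>
    'a \<Rightarrow> 'g \<Rightarrow> 'a \<Rightarrow> ('a, 'k) inf_path set"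
where
  "triple_cylinder G \<Lambda> \<phi> l g m =
    {x \<in> inf_paths \<Lambda>. \<exists>y \<in> inf_paths_to \<Lambda> (Dom G g).
      x = concat_inf \<Lambda> l (act_inf G \<Lambda> \<phi> g y) \<and> x = concat_inf \<Lambda> m y}"


section \<open>Periodicity\<close>

definition deg_diff :: "('k \<Rightarrow> nat) \<Rightarrow> ('k \<Rightarrow> nat) \<Rightarrow> 'k \<Rightarrow> int" where
  "deg_diff p q = (\<lambda>i. int (p i) - int (q i))"

definition Per ::
  "('v, 'g) category \<Rightarrow> ('v, 'a, 'k) kgraph \<Rightarrow> ('g \<Rightarrow> 'v \<times> 'v \<times> ('a \<Rightarrow> 'a)) \<Rightarrow> ('k \<Rightarrow> int) set"
where
  "Per G \<Lambda> \<phi> =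
    {deg_diff p q | p q.
      \<exists>g \<in> Arr G. \<forall>x \<in> inf_paths_to \<Lambda> (Dom G g). shift p x = shift q (act_inf G \<Lambda> \<phi> g x)}"

text \<open>
  The pair \<open>(\<theta>\<^bsub>p,q\<^esub>(\<lambda>), h\<^bsub>p,q\<^esub>(\<lambda>))\<close>; it exists and is unique when \<open>p - q\<close> is a period and
  \<open>\<lambda>\<close> has degree \<open>p\<close>, and is used only then.
\<close>

definition theta_h ::
  "('v, 'g) category \<Rightarrow> ('v, 'a, 'k) kgraph \<Rightarrow> ('g \<Rightarrow> 'v \<times> 'v \<times> ('a \<Rightarrow> 'a)) \<Rightarrow>
    ('k \<Rightarrow> nat) \<Rightarrow> ('k \<Rightarrow> nat) \<Rightarrow> 'a \<Rightarrow> 'a \<times> 'g"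
where
  "theta_h G \<Lambda> \<phi> p q l =
    (THE (m, h). m \<in> paths_of_deg \<Lambda> q \<and> h \<in> Arr G \<and> Cod G h = Dom \<Lambda> l \<and> Dom G h = Dom \<Lambda> m \<and>
      (\<forall>x \<in> inf_paths_to \<Lambda> (Dom G h).
        concat_inf \<Lambda> l (act_inf G \<Lambda> \<phi> h x) = concat_inf \<Lambda> m x))"

definition theta ::
  "('v, 'g) category \<Rightarrow> ('v, 'a, 'k) kgraph \<Rightarrow> ('g \<Rightarrow> 'v \<times> 'v \<times> ('a \<Rightarrow> 'a)) \<Rightarrow>
    ('k \<Rightarrow> nat) \<Rightarrow> ('k \<Rightarrow> nat) \<Rightarrow> 'a \<Rightarrow> 'a"
where
  "theta G \<Lambda> \<phi> p q l = fst (theta_h G \<Lambda> \<phi> p q l)"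

definition h_elt ::
  "('v, 'g) category \<Rightarrow> ('v, 'a, 'k) kgraph \<Rightarrow> ('g \<Rightarrow> 'v \<times> 'v \<times> ('a \<Rightarrow> 'a)) \<Rightarrow>
    ('k \<Rightarrow> nat) \<Rightarrow> ('k \<Rightarrow> nat) \<Rightarrow> 'a \<Rightarrow> 'g"
where
  "h_elt G \<Lambda> \<phi> p q l = snd (theta_h G \<Lambda> \<phi> p q l)"

definition c_coeff ::
  "('v, 'g) category \<Rightarrow> ('v, 'a, 'k::finite) kgraph \<Rightarrow> ('g \<Rightarrow> 'v \<times> 'v \<times> ('a \<Rightarrow> 'a)) \<Rightarrow>
    ('v \<Rightarrow> real) \<Rightarrow> ('k \<Rightarrow> nat) \<Rightarrow> ('k \<Rightarrow> nat) \<Rightarrow> 'a \<Rightarrow> 'g \<Rightarrow> real"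
where
  "c_coeff G \<Lambda> \<phi> \<xi> p q l g =
    lim (\<lambda>t::nat. rho_power \<Lambda> (\<lambda>i. - int t) *
      (\<Sum>v\<in>Obj \<Lambda>. real (card {m \<in> paths_to \<Lambda> (Dom G g) \<inter> paths_of_deg \<Lambda> (\<lambda>i. t) \<inter> paths_from \<Lambda> v.
          act \<phi> g m = act \<phi> (h_elt G \<Lambda> \<phi> p q l) m \<and>
          path_restriction G \<Lambda> \<phi> g m = path_restriction G \<Lambda> \<phi> (h_elt G \<Lambda> \<phi> p q l) m}) * \<xi> v))"

end

theory Submission
  imports Defs
begin

text \<open>
  Write \<open>p = d(\<lambda>)\<close> and \<open>q = d(\<mu>)\<close>. A point of \<open>Z(\<lambda>, g, \<mu>)\<close> is \<open>\<mu>y\<close> with \<open>\<lambda>(g \<cdot> y) = \<mu>y\<close>. If \<open>p - q\<close>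
  is a period, then \<open>\<lambda>(h \<cdot> y) = \<theta>y\<close> for all \<open>y\<close>, so \<open>Z\<close> is empty unless \<open>\<mu> = \<theta>\<close>, and for \<open>\<mu> = \<theta>\<close> it
  consists of the \<open>\<mu>y\<close> with \<open>g \<cdot> y = h \<cdot> y\<close>. This set contains the cylinders of all finite paths on
  which \<open>g\<close> and \<open>h\<close> agree together with their restrictions, whose measures converge to the limit in
  \<open>c(g)\<close>; what remains lies in the cylinders of paths on which \<open>g\<close> and \<open>h\<close> agree but have different
  restrictions. If \<open>p - q\<close> is not a period, then along \<open>y\<close> every restriction \<open>g|\<^sub>\<nu>\<close> satisfies the
  equation \<open>\<sigma>\<^sup>p(z) = \<sigma>\<^sup>q(g|\<^sub>\<nu> \<cdot> z)\<close> at the corresponding tail \<open>z\<close> of \<open>y\<close>, and no element of \<open>G\<close> satisfies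
  it everywhere. In both situations only finitely many restrictions occur, so each finite path has an
  extension of bounded degree that violates the condition, and the remaining measure decays
  geometrically.
\<close>

section \<open>Factorisation in \<open>k\<close>-graphs\<close>

text \<open>The difficulty sits at infinite paths on which \<open>g\<close> and \<open>h\<close>
  have the same effect although their restrictions never become equal: no finite segment of such a
  path certifies the agreement, so every count in \<open>c_coeff\<close> misses it. The case of a
  period and the opposite case both come down to an exceptional set being null, and they share one
  estimate, \<open>measure_decay\<close>, whose hypotheses concern finite paths only. Its uniformity
  comes from the finiteness of the set of restrictions: one \<open>L\<close> bounds all violating
  extensions, and losing one cylinder of diagonal degree \<open>L\<close> costs at least the
  proportion \<open>wt (\<lambda>_. L)\<close> times the smallest entry of \<xi>, because \<xi>
  \<le> 1. Degrees run along the diagonal since constant degrees are cofinal in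
  \<open>'k \<Rightarrow> nat\<close>, which yields a single decreasing sequence of sets. The
  existence of the limit in \<open>c_coeff\<close> comes out of the same estimate and is not
  presupposed.\<close>

lemma fun_le_add_diff:
  fixes p q :: "'k \<Rightarrow> nat"
  shows "p \<le> q \<Longrightarrow> p + (q - p) = q"
  by (auto simp: le_fun_def fun_eq_iff)

lemma fun_le_addI:
  fixes p q :: "'k \<Rightarrow> nat"
  shows "p \<le> p + q" "p \<le> q + p"
  by (auto simp: le_fun_def)

lemma fun_zero_le [simp]: "(0 :: 'k \<Rightarrow> nat) \<le> p"
  "(\<lambda>_. 0 :: nat) \<le> p"
  by (simp_all add: le_fun_def)

lemma fun_diff_zero [simp]: "(p :: 'k \<Rightarrow> nat) - 0 = p"
  by (simp add: fun_eq_iff)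

context k_graph
begin

lemma factorise:
  assumes "a \<in> Arr \<Lambda>" and "deg \<Lambda> a = p + q"
  obtains b c where "b \<in> Arr \<Lambda>" "c \<in> Arr \<Lambda>" "Dom \<Lambda> b = Cod \<Lambda> c" "a = b \<cdot> c"
    "deg \<Lambda> b = p" "deg \<Lambda> c = q"
  using unique_factorisation[OF assms] by auto

text \<open>Degrees add, so equal degrees of the first factors force equal degrees of the second
  ones; both pairs then split the same path in the same way.\<close>

lemma cancel:
  assumes "a \<in> Arr \<Lambda>" "b \<in> Arr \<Lambda>" "Dom \<Lambda> a = Cod \<Lambda> b"
    and "a' \<in> Arr \<Lambda>" "b' \<in> Arr \<Lambda>" "Dom \<Lambda> a' = Cod \<Lambda> b'"
    and "deg \<Lambda> a = deg \<Lambda> a'" and "a \<cdot> b = a' \<cdot> b'"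
  shows "a = a'" "b = b'"
proof -
  have 1: "a \<cdot> b \<in> Arr \<Lambda>" "deg \<Lambda> (a \<cdot> b) = deg \<Lambda> a + deg \<Lambda> b"
    using assms(1-3) by (auto intro: Comp_closed simp: deg_Comp)
  have "deg \<Lambda> a + deg \<Lambda> b = deg \<Lambda> a' + deg \<Lambda> b'"
    using assms by (metis deg_Comp)
  then have "deg \<Lambda> b' = deg \<Lambda> b"
    unfolding assms(7) by (simp add: fun_eq_iff)
  let ?P = "\<lambda>(m, n). m \<in> Arr \<Lambda> \<and> n \<in> Arr \<Lambda> \<and> Dom \<Lambda> m = Cod \<Lambda> n \<and>
    a \<cdot> b = m \<cdot> n \<and> deg \<Lambda> m = deg \<Lambda> a \<and> deg \<Lambda> n = deg \<Lambda> b"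
  have "?P (a, b)" "?P (a', b')"
    using assms(1-7) assms(8)[symmetric] \<open>deg \<Lambda> b' = deg \<Lambda> b\<close> by simp_all
  then have "(a, b) = (a', b')"
    using the1_equality[OF unique_factorisation[OF 1], of "(a, b)"]
      the1_equality[OF unique_factorisation[OF 1], of "(a', b')"] by argo
  then show "a = a'" "b = b'" by auto
qed

lemma left_cancel:
  assumes "a \<in> Arr \<Lambda>" "b \<in> Arr \<Lambda>" "Cod \<Lambda> b = Dom \<Lambda> a" "c \<in> Arr \<Lambda>" "Cod \<Lambda> c = Dom \<Lambda> a"
    and "a \<cdot> b = a \<cdot> c"
  shows "b = c"
  using assms by (metis cancel(2))

text \<open>The path \<open>a\<close> factors as an identity times \<open>a\<close> and as
  \<open>a\<close> times an identity; in both the first factor has degree 0, so the first factors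
  coincide.\<close>

lemma deg_zero_Ide:
  assumes "a \<in> Arr \<Lambda>" "deg \<Lambda> a = 0"
  shows "a = Ide \<Lambda> (Cod \<Lambda> a)"
proof -
  have "Ide \<Lambda> (Cod \<Lambda> a) \<cdot> a = a \<cdot> Ide \<Lambda> (Dom \<Lambda> a)"
    using assms by (simp add: Ide_Comp Comp_Ide)
  then show ?thesis
    using assms cancel(1)[of "Ide \<Lambda> (Cod \<Lambda> a)" a a "Ide \<Lambda> (Dom \<Lambda> a)"]
    by (auto simp: Cod_closed Dom_closed Ide_closed Dom_Ide Cod_Ide deg_Ide)
qed

lemma extensionsI:
  "\<lbrakk>a \<in> Arr \<Lambda>; b \<in> Arr \<Lambda>; Dom \<Lambda> a = Cod \<Lambda> b\<rbrakk> \<Longrightarrow> a \<cdot> b \<in> extensions \<Lambda> a"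
  by (auto simp: extensions_def paths_to_def)

lemma extensionsE:
  assumes "c \<in> extensions \<Lambda> a"
  obtains b where "b \<in> Arr \<Lambda>" "Dom \<Lambda> a = Cod \<Lambda> b" "c = a \<cdot> b"
  using assms by (auto simp: extensions_def paths_to_def)

lemma extensions_trans:
  assumes "a \<in> Arr \<Lambda>" "b \<in> extensions \<Lambda> a" "c \<in> extensions \<Lambda> b"
  shows "c \<in> extensions \<Lambda> a"
proof -
  obtain b' c' where "b' \<in> Arr \<Lambda>" "Dom \<Lambda> a = Cod \<Lambda> b'" "b = a \<cdot> b'"
    "c' \<in> Arr \<Lambda>" "Dom \<Lambda> b = Cod \<Lambda> c'" "c = b \<cdot> c'"
    using assms(2,3) by (auto elim!: extensionsE)
  then show ?thesis
    using assms(1) by (auto simp: Comp_assoc Dom_Comp Cod_Comp Comp_closed intro!: extensionsI)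
qed

lemma extensions_same_deg:
  assumes "a \<in> Arr \<Lambda>" "b \<in> Arr \<Lambda>" "c \<in> extensions \<Lambda> a" "c \<in> extensions \<Lambda> b"
    and "deg \<Lambda> a = deg \<Lambda> b"
  shows "a = b"
  using assms by (auto elim!: extensionsE intro: cancel)

lemma ex_prefix:
  assumes "c \<in> Arr \<Lambda>" "n \<le> deg \<Lambda> c"
  obtains a where "a \<in> Arr \<Lambda>" "deg \<Lambda> a = n" "c \<in> extensions \<Lambda> a"
  using factorise[OF assms(1), of n "deg \<Lambda> c - n"] fun_le_add_diff[OF assms(2)] extensionsI
  by metis

text \<open>The prefix of \<open>b\<close> of degree \<open>deg \<Lambda> a\<close> is also a prefix
  of \<open>c\<close>, and \<open>c\<close> has only one prefix of that degree.\<close>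

lemma extensions_le:
  assumes "a \<in> Arr \<Lambda>" "b \<in> Arr \<Lambda>" "c \<in> extensions \<Lambda> a" "c \<in> extensions \<Lambda> b"
    and "deg \<Lambda> a \<le> deg \<Lambda> b"
  shows "b \<in> extensions \<Lambda> a"
proof -
  obtain a' where a': "a' \<in> Arr \<Lambda>" "deg \<Lambda> a' = deg \<Lambda> a" "b \<in> extensions \<Lambda> a'"
    using ex_prefix assms by metis
  then have "a' = a"
    using assms extensions_same_deg extensions_trans by metis
  then show ?thesis using a' by simp
qed

section \<open>Infinite paths\<close>

lemma inf_path_deg: "x \<in> inf_paths \<Lambda> \<Longrightarrow> p \<le> q \<Longrightarrow> deg \<Lambda> (x (p, q)) = q - p"
  by (auto simp: inf_paths_def Omega_def)

lemma inf_path_Arr: "x \<in> inf_paths \<Lambda> \<Longrightarrow> p \<le> q \<Longrightarrow> x (p, q) \<in> Arr \<Lambda>"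
  by (auto simp: inf_paths_def Omega_def is_functor_def)

lemma inf_path_extensional: "x \<in> inf_paths \<Lambda> \<Longrightarrow> \<not> p \<le> q \<Longrightarrow> x (p, q) = undefined"
  by (auto simp: inf_paths_def Omega_def extensional_def)

lemma inf_path_objects:
  assumes "x \<in> inf_paths \<Lambda>"
  obtains x0 where "\<And>p q. p \<le> q \<Longrightarrow> Dom \<Lambda> (x (p, q)) = x0 q \<and> Cod \<Lambda> (x (p, q)) = x0 p"
proof -
  obtain x0 where "is_functor Omega \<Lambda> x0 x"
    using assms by (auto simp: inf_paths_def)
  then have "\<forall>a \<in> Arr Omega. Dom \<Lambda> (x a) = x0 (Dom Omega a) \<and> Cod \<Lambda> (x a) = x0 (Cod Omega a)"
    unfolding is_functor_def by blast
  then show ?thesis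
    by (intro that[of x0]) (simp add: Omega_def)
qed

lemma inf_path_Dom_Cod:
  "x \<in> inf_paths \<Lambda> \<Longrightarrow> p \<le> q \<Longrightarrow> q \<le> r \<Longrightarrow> Dom \<Lambda> (x (p, q)) = Cod \<Lambda> (x (q, r))"
  using inf_path_objects by metis

lemma inf_path_Cod:
  "x \<in> inf_paths \<Lambda> \<Longrightarrow> p \<le> q \<Longrightarrow> p \<le> r \<Longrightarrow> Cod \<Lambda> (x (p, q)) = Cod \<Lambda> (x (p, r))"
  using inf_path_objects by metis

lemma inf_path_Comp:
  assumes "x \<in> inf_paths \<Lambda>" "p \<le> q" "q \<le> r"
  shows "x (p, q) \<cdot> x (q, r) = x (p, r)"
proof -
  obtain x0 where "is_functor Omega \<Lambda> x0 x"
    using assms(1) by (auto simp: inf_paths_def)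
  then have "\<forall>a \<in> Arr Omega. \<forall>b \<in> Arr Omega.
      Dom Omega a = Cod Omega b \<longrightarrow> x (a \<cdot>\<^bsub>Omega\<^esub> b) = x a \<cdot> x b"
    unfolding is_functor_def by blast
  moreover have "(p, q) \<in> Arr Omega" "(q, r) \<in> Arr Omega" "Dom Omega (p, q) = Cod Omega (q, r)"
    using assms(2,3) by (simp_all add: Omega_def)
  ultimately have "x ((p, q) \<cdot>\<^bsub>Omega\<^esub> (q, r)) = x (p, q) \<cdot> x (q, r)"
    by blast
  then show ?thesis by (simp add: Omega_def)
qed

text \<open>The object map is recovered as \<open>\<lambda>p. Cod \<Lambda> (x (p, p))\<close>.
  Identities need no separate hypothesis, since arrows of degree 0 are identities.\<close>

lemma inf_pathsI:
  assumes ext: "\<And>p q. \<not> p \<le> q \<Longrightarrow> x (p, q) = undefined"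
    and Arr: "\<And>p q. p \<le> q \<Longrightarrow> x (p, q) \<in> Arr \<Lambda>"
    and deg: "\<And>p q. p \<le> q \<Longrightarrow> deg \<Lambda> (x (p, q)) = q - p"
    and Dom: "\<And>p q r. p \<le> q \<Longrightarrow> q \<le> r \<Longrightarrow> Dom \<Lambda> (x (p, q)) = Cod \<Lambda> (x (q, r))"
    and Comp: "\<And>p q r. p \<le> q \<Longrightarrow> q \<le> r \<Longrightarrow> x (p, q) \<cdot> x (q, r) = x (p, r)"
  shows "x \<in> inf_paths \<Lambda>"
proof -
  have Cod: "Cod \<Lambda> (x (p, q)) = Cod \<Lambda> (x (p, p))" if "p \<le> q" for p q
    using Cod_Comp[of "x (p, p)" "x (p, q)"] that Arr Dom Comp by auto
  have "is_functor Omega \<Lambda> (\<lambda>p. Cod \<Lambda> (x (p, p))) x"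
    unfolding is_functor_def
  proof (intro conjI ballI impI)
    show "(\<lambda>p. Cod \<Lambda> (x (p, p))) \<in> Obj Omega \<rightarrow> Obj \<Lambda>"
      using Arr Cod_closed by simp
    show "x \<in> Arr Omega \<rightarrow> Arr \<Lambda>"
      using Arr by (auto simp: Omega_def)
    show "x (Ide Omega p) = Ide \<Lambda> (Cod \<Lambda> (x (p, p)))" for p
      using deg_zero_Ide[of "x (p, p)"] Arr deg[of p p] by (simp add: Omega_def fun_eq_iff)
    fix a :: "('k \<Rightarrow> nat) \<times> ('k \<Rightarrow> nat)" assume "a \<in> Arr Omega"
    then obtain p q where a: "a = (p, q)" "p \<le> q" by (auto simp: Omega_def)
    show "Dom \<Lambda> (x a) = Cod \<Lambda> (x (Dom Omega a, Dom Omega a))"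
      using Dom[of p q q] a by (simp add: Omega_def)
    show "Cod \<Lambda> (x a) = Cod \<Lambda> (x (Cod Omega a, Cod Omega a))"
      using Cod[of p q] a by (simp add: Omega_def)
    fix b :: "('k \<Rightarrow> nat) \<times> ('k \<Rightarrow> nat)" assume "b \<in> Arr Omega" "Dom Omega a = Cod Omega b"
    then obtain r where "b = (q, r)" "q \<le> r" using a by (auto simp: Omega_def)
    then show "x (a \<cdot>\<^bsub>Omega\<^esub> b) = x a \<cdot> x b"
      using Comp[of p q r] a by (simp add: Omega_def)
  qed
  then show ?thesis
    unfolding inf_paths_def using ext deg by (auto simp: Omega_def extensional_def)
qed

lemma inf_path_0_deg: "x \<in> inf_paths \<Lambda> \<Longrightarrow> deg \<Lambda> (x (0, n)) = n"
  by (simp add: inf_path_deg)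

lemma inf_path_0_Arr: "x \<in> inf_paths \<Lambda> \<Longrightarrow> x (0, n) \<in> Arr \<Lambda>"
  by (simp add: inf_path_Arr)

lemma inf_path_extensions:
  assumes "x \<in> inf_paths \<Lambda>" "p \<le> q"
  shows "x (0, q) \<in> extensions \<Lambda> (x (0, p))"
  using extensionsI[of "x (0, p)" "x (p, q)"] inf_path_Comp[of x 0 p q] inf_path_Dom_Cod[of x 0 p q]
    assms by (simp add: inf_path_Arr)

lemma inf_path_prefix_eq:
  assumes "x \<in> inf_paths \<Lambda>" "x (0, q) \<in> extensions \<Lambda> a" "a \<in> Arr \<Lambda>" "deg \<Lambda> a \<le> q"
  shows "x (0, deg \<Lambda> a) = a"
  using assms
  by (intro extensions_same_deg[of _ _ "x (0, q)"]) (auto simp: inf_path_0_Arr inf_path_0_deg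
      intro: inf_path_extensions)

lemma inf_path_eq_mono:
  assumes "x \<in> inf_paths \<Lambda>" "y \<in> inf_paths \<Lambda>" "x (0, q) = y (0, q)" "p \<le> q"
  shows "x (0, p) = y (0, p)"
  using inf_path_prefix_eq[of x q "y (0, p)"] inf_path_extensions[of y p q] assms
  by (simp add: inf_path_0_Arr inf_path_0_deg)

text \<open>Cancelling the common prefix \<open>x (0, p)\<close> from \<open>x (0, q)\<close> leaves
  the segment. Equality of infinite paths can therefore be tested on initial segments alone.\<close>

lemma inf_path_segment_eq:
  assumes x: "x \<in> inf_paths \<Lambda>" and y: "y \<in> inf_paths \<Lambda>"
    and eq: "x (0, q) = y (0, q)" and "p \<le> q"
  shows "x (p, q) = y (p, q)"
proof -
  have "x (0, p) = y (0, p)" using inf_path_eq_mono assms by metis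
  then show ?thesis
    using cancel(2)[of "x (0, p)" "x (p, q)" "y (0, p)" "y (p, q)"] assms
      inf_path_Comp[of x 0 p q] inf_path_Dom_Cod[of x 0 p q]
      inf_path_Comp[of y 0 p q] inf_path_Dom_Cod[of y 0 p q]
    by (auto simp: inf_path_Arr)
qed

lemma inf_path_eqI:
  assumes "x \<in> inf_paths \<Lambda>" "y \<in> inf_paths \<Lambda>" "\<And>n. x (0, n) = y (0, n)"
  shows "x = y"
proof
  fix a show "x a = y a"
    using assms inf_path_extensional inf_path_segment_eq
    by (cases a) metis
qed

lemma le_const:
  fixes n :: "'k \<Rightarrow> nat"
  obtains t where "n \<le> (\<lambda>_. t)"
proof
  show "n \<le> (\<lambda>_. \<Sum>i\<in>UNIV. n i)"
    by (auto simp: le_fun_def intro: member_le_sum)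
qed

text \<open>Constant degrees are cofinal because \<open>'k\<close> is finite, so diagonal segments
  determine all the others.\<close>

lemma inf_path_eqI_diag:
  assumes "x \<in> inf_paths \<Lambda>" "y \<in> inf_paths \<Lambda>" "\<And>t. x (0, \<lambda>_. t) = y (0, \<lambda>_. t)"
  shows "x = y"
  using assms inf_path_eq_mono le_const by (metis inf_path_eqI)

text \<open>The segment at \<open>(p, q)\<close> is the remainder \<open>s p q\<close> of
  \<open>f q\<close> after \<open>f p\<close>; remainders are unique, hence they compose
  functorially.\<close>

lemma ex_inf_path_of_prefixes:
  assumes Arr: "\<And>n. f n \<in> Arr \<Lambda>" and deg: "\<And>n. deg \<Lambda> (f n) = n"
    and ext: "\<And>p q. p \<le> q \<Longrightarrow> f q \<in> extensions \<Lambda> (f p)"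
  obtains x where "x \<in> inf_paths \<Lambda>" "\<And>n. x (0, n) = f n"
proof -
  have "\<exists>a. p \<le> q \<longrightarrow> a \<in> Arr \<Lambda> \<and> Dom \<Lambda> (f p) = Cod \<Lambda> a \<and> f q = f p \<cdot> a" for p q
    using ext by (metis extensionsE)
  then obtain s where s: "\<And>p q. p \<le> q \<Longrightarrow> s p q \<in> Arr \<Lambda> \<and> Dom \<Lambda> (f p) = Cod \<Lambda> (s p q) \<and> f q = f p \<cdot> s p q"
    by metis
  have Dom_s: "Dom \<Lambda> (s p q) = Dom \<Lambda> (f q)" if "p \<le> q" for p q
    using s[OF that] Arr by (metis Dom_Comp)
  define x where "x = (\<lambda>(p, q). if p \<le> q then s p q else undefined)"
  have "x \<in> inf_paths \<Lambda>"
  proof (rule inf_pathsI)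
    fix p q r :: "'k \<Rightarrow> nat" assume le: "p \<le> q"
    show "x (p, q) \<in> Arr \<Lambda>" using s le by (simp add: x_def)
    have "deg \<Lambda> (f p) + deg \<Lambda> (s p q) = deg \<Lambda> (f q)"
      using s[OF le] Arr deg_Comp by metis
    then show "deg \<Lambda> (x (p, q)) = q - p" using le by (simp add: x_def deg fun_eq_iff) (metis add_diff_cancel_left')
    assume le': "q \<le> r"
    then have le'': "p \<le> r" using le by simp
    show "Dom \<Lambda> (x (p, q)) = Cod \<Lambda> (x (q, r))"
      using s[OF le'] Dom_s[OF le] le le' by (simp add: x_def)
    have "f p \<cdot> (s p q \<cdot> s q r) = f p \<cdot> s p r"
      using s[OF le] s[OF le'] s[OF le''] Dom_s[OF le] Arr by (metis Comp_assoc)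
    then have "s p q \<cdot> s q r = s p r"
      using s[OF le] s[OF le'] s[OF le''] Dom_s[OF le] Arr
      by (intro cancel(2)[of "f p" "s p q \<cdot> s q r" "f p" "s p r"]) (auto simp: Cod_Comp Comp_closed)
    then show "x (p, q) \<cdot> x (q, r) = x (p, r)"
      using le le' le'' by (simp add: x_def)
  qed (simp add: x_def)
  moreover have "x (0, n) = f n" for n
  proof -
    \<comment> \<open>Since \<open>f 0\<close> is an identity, the remainder after it is all of
      \<open>f n\<close>.\<close>
    have "f 0 = Ide \<Lambda> (Cod \<Lambda> (f 0))" using deg_zero_Ide Arr deg by metis
    then have "Dom \<Lambda> (f 0) = Cod \<Lambda> (f 0)" using Arr by (metis Cod_closed Dom_Ide)
    with \<open>f 0 = _\<close> have "f 0 \<cdot> s 0 n = s 0 n"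
      using s[of 0 n] Ide_Comp by (metis fun_zero_le)
    then show ?thesis using s[of 0 n] by (simp add: x_def)
  qed
  ultimately show ?thesis using that by blast
qed

section \<open>Shifts and concatenation of infinite paths\<close>

lemma shift_inf_path:
  assumes "x \<in> inf_paths \<Lambda>"
  shows "shift n x \<in> inf_paths \<Lambda>"
proof (rule inf_pathsI)
  fix p q r :: "'k \<Rightarrow> nat" assume le: "p \<le> q"
  then have le1: "p + n \<le> q + n" by (simp add: le_fun_def)
  show "shift n x (p, q) \<in> Arr \<Lambda>"
    using inf_path_Arr[OF assms le1] le by (simp add: shift_def Omega_def)
  show "deg \<Lambda> (shift n x (p, q)) = q - p"
    using inf_path_deg[OF assms le1] le by (simp add: shift_def Omega_def fun_eq_iff)
  assume le': "q \<le> r"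
  then have le2: "q + n \<le> r + n" by (simp add: le_fun_def)
  show "Dom \<Lambda> (shift n x (p, q)) = Cod \<Lambda> (shift n x (q, r))"
    using inf_path_Dom_Cod[OF assms le1 le2] le le' by (simp add: shift_def Omega_def)
  show "shift n x (p, q) \<cdot> shift n x (q, r) = shift n x (p, r)"
    using inf_path_Comp[OF assms le1 le2] le le' by (auto simp: shift_def Omega_def)
qed (simp add: shift_def Omega_def)

lemma shift_apply: "p \<le> q \<Longrightarrow> shift n x (p, q) = x (p + n, q + n)"
  by (simp add: shift_def Omega_def)

lemma shift_shift:
  fixes x :: "('a, 'k) inf_path"
  assumes "x \<in> inf_paths \<Lambda>"
  shows "shift m (shift n x) = shift (n + m) x"
proof
  fix a :: "('k \<Rightarrow> nat) \<times> ('k \<Rightarrow> nat)"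
  show "shift m (shift n x) a = shift (n + m) x a"
    by (cases a) (auto simp: shift_def Omega_def le_fun_def add.assoc add.commute[of n m])
qed

lemma inf_range_0: "x \<in> inf_paths \<Lambda> \<Longrightarrow> Cod \<Lambda> (x (0, n)) = inf_range \<Lambda> x"
  unfolding inf_range_def by (rule inf_path_Cod) auto

lemma inf_range_shift: "x \<in> inf_paths \<Lambda> \<Longrightarrow> inf_range \<Lambda> (shift n x) = Dom \<Lambda> (x (0, n))"
  by (simp add: inf_range_def shift_apply inf_path_Dom_Cod[of x 0 n n])

lemma inf_path_0_add:
  assumes "x \<in> inf_paths \<Lambda>"
  shows "x (0, n + m) = x (0, n) \<cdot> shift n x (0, m)"
proof -
  have "n \<le> m + n" by (rule fun_le_addI)
  then show ?thesis
    using inf_path_Comp[OF assms, of 0 n "n + m"] by (simp add: shift_apply add.commute)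
qed

lemma inf_path_eq_shift:
  assumes "x \<in> inf_paths \<Lambda>" "y \<in> inf_paths \<Lambda>" "x (0, n) = y (0, n)" "shift n x = shift n y"
  shows "x = y"
proof (rule inf_path_eqI)
  fix m
  have "x (0, n + m) = y (0, n + m)" using assms by (simp add: inf_path_0_add)
  then show "x (0, m) = y (0, m)" using inf_path_eq_mono assms fun_le_addI by metis
qed (use assms in auto)

lemma ex_concat:
  assumes a: "a \<in> Arr \<Lambda>" and y: "y \<in> inf_paths_to \<Lambda> (Dom \<Lambda> a)"
  shows "\<exists>x. x \<in> inf_paths \<Lambda> \<and> x (0, deg \<Lambda> a) = a \<and> shift (deg \<Lambda> a) x = y"
proof -
  let ?d = "deg \<Lambda> a"
  have yi: "y \<in> inf_paths \<Lambda>" using y by (simp add: inf_paths_to_def)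
  have Cod_y: "Cod \<Lambda> (y (0, n)) = Dom \<Lambda> a" for n
    using y inf_range_0 by (auto simp: inf_paths_to_def)
  have ay: "a \<cdot> y (0, n) \<in> Arr \<Lambda>" "deg \<Lambda> (a \<cdot> y (0, n)) = ?d + n" for n
    using a yi Cod_y by (auto simp: inf_path_0_Arr inf_path_0_deg deg_Comp Comp_closed)
  have ay_ext: "a \<cdot> y (0, q) \<in> extensions \<Lambda> (a \<cdot> y (0, p))" if "p \<le> q" for p q
  proof -
    have c: "y (0, p) \<cdot> y (p, q) = y (0, q)" "Dom \<Lambda> (y (0, p)) = Cod \<Lambda> (y (p, q))"
      using inf_path_Comp[OF yi, of 0 p q] inf_path_Dom_Cod[OF yi, of 0 p q] that by auto
    then have "a \<cdot> y (0, q) = (a \<cdot> y (0, p)) \<cdot> y (p, q)"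
      using a yi Cod_y that by (subst Comp_assoc) (auto simp: inf_path_Arr)
    then show ?thesis
      using a yi Cod_y that c by (auto simp: inf_path_Arr Comp_closed Dom_Comp intro!: extensionsI)
  qed
  \<comment> \<open>The path \<open>a \<cdot> y (0, n)\<close> is too long by the degree of
    \<open>a\<close>; its prefix of degree \<open>n\<close> makes sense even when \<open>n\<close>
    and the degree of \<open>a\<close> are incomparable.\<close>
  have "\<exists>b. b \<in> Arr \<Lambda> \<and> deg \<Lambda> b = n \<and> a \<cdot> y (0, n) \<in> extensions \<Lambda> b" for n
    using ex_prefix[OF ay(1)[of n], of n] ay(2) fun_le_addI(2)[of n ?d] by metis
  then obtain f where f: "\<And>n. f n \<in> Arr \<Lambda>" "\<And>n. deg \<Lambda> (f n) = n"
    "\<And>n. a \<cdot> y (0, n) \<in> extensions \<Lambda> (f n)" by metis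
  have f': "a \<cdot> y (0, q) \<in> extensions \<Lambda> (f p)" if "p \<le> q" for p q
    using extensions_trans f ay_ext[OF that] by blast
  obtain x where x: "x \<in> inf_paths \<Lambda>" "\<And>n. x (0, n) = f n"
  proof (rule ex_inf_path_of_prefixes[of f])
    show "f q \<in> extensions \<Lambda> (f p)" if "p \<le> q" for p q
      using extensions_le[OF f(1) f(1) f'[OF that] f'[of q q]] f(2) that by auto
  qed (use f in auto)
  have x_add: "x (0, ?d + n) = a \<cdot> y (0, n)" for n
    using extensions_same_deg[of "f (?d + n)" "a \<cdot> y (0, n)" "a \<cdot> y (0, ?d + n)"]
      ay f fun_le_addI(2)[of n ?d] ay_ext[of n "?d + n"] x(2) by auto
  have "x (0, ?d) = a"
    using extensions_same_deg[of "f ?d" a "a \<cdot> y (0, ?d)"] f a Cod_y[of ?d] x(2)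
      extensionsI[OF a inf_path_0_Arr[OF yi], of ?d] by simp
  moreover have "shift ?d x = y"
  proof (rule inf_path_eqI)
    fix n
    have "a \<cdot> shift ?d x (0, n) = a \<cdot> y (0, n)"
      using inf_path_0_add[OF x(1), of ?d n] x_add[of n] calculation by simp
    then show "shift ?d x (0, n) = y (0, n)"
      using a yi x(1) Cod_y calculation
      by (intro cancel(2)[of a "shift ?d x (0, n)" a "y (0, n)"])
        (auto simp: inf_path_0_Arr shift_inf_path inf_range_0 inf_range_shift)
  qed (use x yi in \<open>auto intro: shift_inf_path\<close>)
  ultimately show ?thesis using x by blast
qed

text \<open>A prefix and the tail after it determine an infinite path, so the \<open>THE\<close> in
  \<open>concat_inf\<close> denotes the path found in \<open>ex_concat\<close>.\<close>

lemma concat_inf: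
  assumes "a \<in> Arr \<Lambda>" "y \<in> inf_paths_to \<Lambda> (Dom \<Lambda> a)"
  shows concat_inf_path: "concat_inf \<Lambda> a y \<in> inf_paths \<Lambda>"
    and concat_inf_prefix: "concat_inf \<Lambda> a y (0, deg \<Lambda> a) = a"
    and shift_concat_inf: "shift (deg \<Lambda> a) (concat_inf \<Lambda> a y) = y"
proof -
  have "\<exists>!x. x \<in> inf_paths \<Lambda> \<and> x (0, deg \<Lambda> a) = a \<and> shift (deg \<Lambda> a) x = y"
    using ex_concat[OF assms] inf_path_eq_shift by (metis (no_types, lifting))
  from theI'[OF this] show "concat_inf \<Lambda> a y \<in> inf_paths \<Lambda>"
    "concat_inf \<Lambda> a y (0, deg \<Lambda> a) = a" "shift (deg \<Lambda> a) (concat_inf \<Lambda> a y) = y"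
    unfolding concat_inf_def by auto
qed

lemma concat_inf_inject:
  assumes "a \<in> Arr \<Lambda>" "y \<in> inf_paths_to \<Lambda> (Dom \<Lambda> a)"
    and "b \<in> Arr \<Lambda>" "z \<in> inf_paths_to \<Lambda> (Dom \<Lambda> b)"
    and "deg \<Lambda> a = deg \<Lambda> b" "concat_inf \<Lambda> a y = concat_inf \<Lambda> b z"
  shows "a = b" "y = z"
  using assms by (metis concat_inf_prefix, metis shift_concat_inf)

lemma concat_inf_eqI:
  assumes "x \<in> inf_paths \<Lambda>" "x (0, deg \<Lambda> a) = a"
  shows "shift (deg \<Lambda> a) x \<in> inf_paths_to \<Lambda> (Dom \<Lambda> a)"
    and "concat_inf \<Lambda> a (shift (deg \<Lambda> a) x) = x"
proof -
  show *: "shift (deg \<Lambda> a) x \<in> inf_paths_to \<Lambda> (Dom \<Lambda> a)"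
    using assms by (simp add: inf_paths_to_def shift_inf_path inf_range_shift)
  have a: "a \<in> Arr \<Lambda>" using assms inf_path_0_Arr by metis
  show "concat_inf \<Lambda> a (shift (deg \<Lambda> a) x) = x"
    using assms concat_inf[OF a *] inf_path_eq_shift by metis
qed

lemma concat_inf_0_add:
  assumes "a \<in> Arr \<Lambda>" "y \<in> inf_paths_to \<Lambda> (Dom \<Lambda> a)"
  shows "concat_inf \<Lambda> a y (0, deg \<Lambda> a + n) = a \<cdot> y (0, n)"
  using inf_path_0_add[OF concat_inf_path[OF assms]] concat_inf[OF assms] by simp

lemma concat_inf_range:
  assumes "a \<in> Arr \<Lambda>" "y \<in> inf_paths_to \<Lambda> (Dom \<Lambda> a)"
  shows "concat_inf \<Lambda> a y \<in> inf_paths_to \<Lambda> (Cod \<Lambda> a)"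
  using concat_inf(1,2)[OF assms] inf_range_0[of "concat_inf \<Lambda> a y" "deg \<Lambda> a"]
  by (simp add: inf_paths_to_def)

lemma shift_add_concat_inf:
  assumes "a \<in> Arr \<Lambda>" "y \<in> inf_paths_to \<Lambda> (Dom \<Lambda> a)"
  shows "shift (deg \<Lambda> a + n) (concat_inf \<Lambda> a y) = shift n y"
  using shift_shift[OF concat_inf_path[OF assms], of n "deg \<Lambda> a"] shift_concat_inf[OF assms]
  by simp

lemma concat_inf_Comp:
  assumes a: "a \<in> Arr \<Lambda>" and b: "b \<in> Arr \<Lambda>" and ab: "Dom \<Lambda> a = Cod \<Lambda> b"
    and y: "y \<in> inf_paths_to \<Lambda> (Dom \<Lambda> b)"
  shows "concat_inf \<Lambda> (a \<cdot> b) y = concat_inf \<Lambda> a (concat_inf \<Lambda> b y)"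
proof -
  let ?x = "concat_inf \<Lambda> a (concat_inf \<Lambda> b y)"
  have bya: "concat_inf \<Lambda> b y \<in> inf_paths_to \<Lambda> (Dom \<Lambda> a)"
    using concat_inf_range[OF b y] ab by simp
  have "?x (0, deg \<Lambda> (a \<cdot> b)) = a \<cdot> b"
    using concat_inf_0_add[OF a bya] concat_inf_prefix[OF b y] a b ab by (simp add: deg_Comp)
  moreover have "shift (deg \<Lambda> (a \<cdot> b)) ?x = y"
    using shift_add_concat_inf[OF a bya] shift_concat_inf[OF b y] a b ab by (simp add: deg_Comp)
  ultimately show ?thesis
    using concat_inf_eqI(2)[OF concat_inf_path[OF a bya]] by metis
qed

section \<open>Cylinders as conditions on a single initial segment\<close>

lemma cylinder_eq:
  assumes "a \<in> Arr \<Lambda>"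
  shows "cylinder \<Lambda> a = {x \<in> inf_paths \<Lambda>. x (0, deg \<Lambda> a) = a}"
proof (intro equalityI subsetI)
  fix x assume "x \<in> cylinder \<Lambda> a"
  then show "x \<in> {x \<in> inf_paths \<Lambda>. x (0, deg \<Lambda> a) = a}"
    using concat_inf(1,2)[OF assms] by (auto simp: cylinder_def)
next
  fix x assume "x \<in> {x \<in> inf_paths \<Lambda>. x (0, deg \<Lambda> a) = a}"
  then have "x = concat_inf \<Lambda> a (shift (deg \<Lambda> a) x)"
    "shift (deg \<Lambda> a) x \<in> inf_paths_to \<Lambda> (Dom \<Lambda> a)"
    using concat_inf_eqI[of x a] by simp_all
  then show "x \<in> cylinder \<Lambda> a"
    unfolding cylinder_def by (rule image_eqI)
qed

lemma cylinder_Comp: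
  assumes "a \<in> Arr \<Lambda>" "b \<in> Arr \<Lambda>" "Dom \<Lambda> a = Cod \<Lambda> b"
  shows "cylinder \<Lambda> (a \<cdot> b) \<subseteq> cylinder \<Lambda> a"
  using assms inf_path_prefix_eq[of _ "deg \<Lambda> a + deg \<Lambda> b" a] extensionsI[OF assms]
    fun_le_addI(1)[of "deg \<Lambda> a" "deg \<Lambda> b"]
  by (auto simp: cylinder_eq Comp_closed deg_Comp)

lemma cylinder_disjoint:
  assumes "a \<in> Arr \<Lambda>" "b \<in> Arr \<Lambda>" "deg \<Lambda> a = deg \<Lambda> b" "a \<noteq> b"
  shows "cylinder \<Lambda> a \<inter> cylinder \<Lambda> b = {}"
  using assms by (auto simp: cylinder_eq)

end

section \<open>Self-similar actions\<close>

locale self_similar = k_graph \<Lambda> for \<Lambda> :: "('v, 'a, 'k::finite) kgraph" (structure) +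
  fixes G :: "('v, 'g) category" and \<phi> :: "'g \<Rightarrow> 'v \<times> 'v \<times> ('a \<Rightarrow> 'a)"
  assumes self_similar: "self_similar_action G \<Lambda> \<phi>"
begin

abbreviation res :: "'g \<Rightarrow> 'a \<Rightarrow> 'g" where
  "res \<equiv> path_restriction G \<Lambda> \<phi>"

abbreviation iact :: "'g \<Rightarrow> ('a, 'k) inf_path \<Rightarrow> ('a, 'k) inf_path" where
  "iact \<equiv> act_inf G \<Lambda> \<phi>"

lemma faithful: "faithful_action G \<Lambda> \<phi>"
  using self_similar by (simp add: self_similar_action_def)

lemma groupoid_G: "groupoid G" and Obj_G: "Obj G = Obj \<Lambda>"
  using faithful by (simp_all add: faithful_action_def)

lemma category_G: "category G"
  using groupoid_G by (rule groupoid.axioms)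

lemma functor_\<phi>: "is_functor G (PIso \<Lambda>) (\<lambda>v. v) \<phi>"
  using faithful by (simp add: faithful_action_def)

lemma \<phi>_eq:
  assumes "g \<in> Arr G"
  shows "\<phi> g = (Dom G g, Cod G g, act \<phi> g)" and "partial_iso \<Lambda> (Dom G g) (Cod G g) (act \<phi> g)"
proof -
  have 1: "\<phi> g \<in> Arr (PIso \<Lambda>)"
    using functor_\<phi> assms unfolding is_functor_def by blast
  have 2: "Dom (PIso \<Lambda>) (\<phi> g) = Dom G g" "Cod (PIso \<Lambda>) (\<phi> g) = Cod G g"
    using functor_\<phi> assms unfolding is_functor_def by blast+
  show 3: "\<phi> g = (Dom G g, Cod G g, act \<phi> g)"
    using 2 by (cases "\<phi> g") (simp add: PIso_def act_def[abs_def])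
  show "partial_iso \<Lambda> (Dom G g) (Cod G g) (act \<phi> g)"
    using 1 by (subst (asm) 3) (simp add: PIso_def)
qed

text \<open>Partial isomorphisms are stored as extensional maps, so agreement on the paths of the
  domain makes the triples equal, and faithfulness does the rest.\<close>

lemma arrow_eqI:
  assumes "g \<in> Arr G" "h \<in> Arr G" "Dom G g = Dom G h" "Cod G g = Cod G h"
    and "\<And>a. a \<in> Arr \<Lambda> \<Longrightarrow> Cod \<Lambda> a = Dom G h \<Longrightarrow> act \<phi> g a = act \<phi> h a"
  shows "g = h"
proof -
  have "act \<phi> g = act \<phi> h"
  proof (rule extensionalityI)
    show "act \<phi> g \<in> extensional (paths_to \<Lambda> (Dom G h))" "act \<phi> h \<in> extensional (paths_to \<Lambda> (Dom G h))"
      using \<phi>_eq(2)[OF assms(1)] \<phi>_eq(2)[OF assms(2)] assms(3) by (simp_all add: partial_iso_def)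
  qed (simp add: assms paths_to_def)
  then have "\<phi> g = \<phi> h"
    using assms(1-4) \<phi>_eq(1)[of g] \<phi>_eq(1)[of h] by simp
  then show ?thesis
    using faithful assms(1,2) by (simp add: faithful_action_def inj_on_def)
qed

lemma act_path:
  assumes "g \<in> Arr G" "a \<in> Arr \<Lambda>" "Cod \<Lambda> a = Dom G g"
  shows "act \<phi> g a \<in> Arr \<Lambda>" and "Cod \<Lambda> (act \<phi> g a) = Cod G g"
    and "deg \<Lambda> (act \<phi> g a) = deg \<Lambda> a"
proof -
  have "act \<phi> g ` (paths_to \<Lambda> (Dom G g) \<inter> paths_of_deg \<Lambda> (deg \<Lambda> a)) =
      paths_to \<Lambda> (Cod G g) \<inter> paths_of_deg \<Lambda> (deg \<Lambda> a)"
    using \<phi>_eq(2)[OF assms(1)] unfolding partial_iso_def by blast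
  moreover have "a \<in> paths_to \<Lambda> (Dom G g) \<inter> paths_of_deg \<Lambda> (deg \<Lambda> a)"
    using assms by (simp add: paths_to_def paths_of_deg_def)
  ultimately have "act \<phi> g a \<in> paths_to \<Lambda> (Cod G g) \<inter> paths_of_deg \<Lambda> (deg \<Lambda> a)"
    by blast
  then show "act \<phi> g a \<in> Arr \<Lambda>" "Cod \<Lambda> (act \<phi> g a) = Cod G g" "deg \<Lambda> (act \<phi> g a) = deg \<Lambda> a"
    by (auto simp: paths_to_def paths_of_deg_def)
qed

lemma act_Comp:
  assumes "g \<in> Arr G" "h \<in> Arr G" "Dom G g = Cod G h" "a \<in> Arr \<Lambda>" "Cod \<Lambda> a = Dom G h"
  shows "act \<phi> (g \<cdot>\<^bsub>G\<^esub> h) a = act \<phi> g (act \<phi> h a)"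
proof -
  have "\<phi> (g \<cdot>\<^bsub>G\<^esub> h) = \<phi> g \<cdot>\<^bsub>PIso \<Lambda>\<^esub> \<phi> h"
    using functor_\<phi> assms unfolding is_functor_def by blast
  then have "snd (snd (\<phi> (g \<cdot>\<^bsub>G\<^esub> h))) = compose (paths_to \<Lambda> (Dom G h)) (act \<phi> g) (act \<phi> h)"
    using \<phi>_eq(1)[OF assms(1)] \<phi>_eq(1)[OF assms(2)] by (simp add: PIso_def)
  then show ?thesis
    using assms(4,5) by (simp add: act_def compose_def paths_to_def)
qed

lemma act_Ide:
  assumes "a \<in> Arr \<Lambda>"
  shows "act \<phi> (Ide G (Cod \<Lambda> a)) a = a"
proof -
  have "Cod \<Lambda> a \<in> Obj G" using assms by (simp add: Cod_closed Obj_G)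
  then have "\<phi> (Ide G (Cod \<Lambda> a)) = Ide (PIso \<Lambda>) (Cod \<Lambda> a)"
    using functor_\<phi> unfolding is_functor_def by blast
  then show ?thesis
    using assms by (simp add: PIso_def act_def paths_to_def)
qed

lemma inverse_arrow:
  assumes "g \<in> Arr G"
  obtains h where "h \<in> Arr G" "Dom G h = Cod G g" "Cod G h = Dom G g"
    "\<And>a. a \<in> Arr \<Lambda> \<Longrightarrow> Cod \<Lambda> a = Dom G g \<Longrightarrow> act \<phi> h (act \<phi> g a) = a"
    "\<And>a. a \<in> Arr \<Lambda> \<Longrightarrow> Cod \<Lambda> a = Cod G g \<Longrightarrow> act \<phi> g (act \<phi> h a) = a"
proof -
  obtain h where h: "h \<in> Arr G" "Dom G h = Cod G g" "Cod G h = Dom G g"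
    "g \<cdot>\<^bsub>G\<^esub> h = Ide G (Cod G g)" "h \<cdot>\<^bsub>G\<^esub> g = Ide G (Dom G g)"
    using groupoid.invertible[OF groupoid_G assms] by blast
  show ?thesis
  proof (rule that[OF h(1-3)])
    fix a assume a: "a \<in> Arr \<Lambda>"
    show "act \<phi> h (act \<phi> g a) = a" if "Cod \<Lambda> a = Dom G g"
      using act_Comp[OF h(1) assms h(2) a that] h(5) act_Ide[OF a] that by simp
    show "act \<phi> g (act \<phi> h a) = a" if "Cod \<Lambda> a = Cod G g"
      using act_Comp[OF assms h(1) _ a] h act_Ide[OF a] that by simp
  qed
qed

lemma act_Ide_path:
  assumes "g \<in> Arr G"
  shows "act \<phi> g (Ide \<Lambda> (Dom G g)) = Ide \<Lambda> (Cod G g)"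
proof -
  have "Dom G g \<in> Obj \<Lambda>"
    using category.Dom_closed[OF category_G assms] Obj_G by simp
  then show ?thesis
    using deg_zero_Ide[of "act \<phi> g (Ide \<Lambda> (Dom G g))"] act_path[OF assms, of "Ide \<Lambda> (Dom G g)"]
    by (simp add: Ide_closed Cod_Ide deg_Ide)
qed

section \<open>Restrictions of groupoid elements along paths\<close>

lemma is_edge_restriction_unique:
  assumes g: "g \<in> Arr G" and a: "a \<in> Arr \<Lambda>" "Cod \<Lambda> a = Dom G g"
    and h: "is_edge_restriction G \<Lambda> \<phi> g a h" and h': "is_edge_restriction G \<Lambda> \<phi> g a h'"
  shows "h = h'"
proof (rule arrow_eqI)
  note act = act_path[OF g a]
  fix b assume b: "b \<in> Arr \<Lambda>" "Cod \<Lambda> b = Dom G h'"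
  have "act \<phi> g a \<cdot> act \<phi> h b = act \<phi> g a \<cdot> act \<phi> h' b"
    using h h' b by (simp add: is_edge_restriction_def paths_to_def)
  then show "act \<phi> h b = act \<phi> h' b"
    using h h' b act act_path[of h b] act_path[of h' b]
    by (intro cancel(2)[of "act \<phi> g a" "act \<phi> h b" "act \<phi> g a" "act \<phi> h' b"])
      (auto simp: is_edge_restriction_def)
qed (use h h' in \<open>auto simp: is_edge_restriction_def\<close>)

lemma edge_restriction:
  assumes "g \<in> Arr G" "e \<in> edges \<Lambda>" "Cod \<Lambda> e = Dom G g"
  shows "is_edge_restriction G \<Lambda> \<phi> g e (edge_restriction G \<Lambda> \<phi> g e)"
proof -
  have e: "e \<in> Arr \<Lambda>" using assms(2) by (auto simp: edges_def paths_of_deg_def)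
  then have "\<exists>h. is_edge_restriction G \<Lambda> \<phi> g e h"
    using self_similar assms by (auto simp: self_similar_action_def paths_to_def)
  then have "\<exists>!h. is_edge_restriction G \<Lambda> \<phi> g e h"
    using is_edge_restriction_unique[OF assms(1) e assms(3)] by blast
  then show ?thesis
    unfolding edge_restriction_def by (rule theI')
qed

lemma edge_factorisation_Arr: "edge_factorisation \<Lambda> es a \<Longrightarrow> a \<in> Arr \<Lambda>"
  by (induction rule: edge_factorisation.induct)
    (auto simp: Ide_closed edges_def paths_of_deg_def intro: Comp_closed)

text \<open>The condition \<open>is_edge_restriction\<close> makes sense for any path in place of an
  edge and has at most one solution there. Every fold over an edge list solves it for the composed
  path, which is why the fold does not depend on the factorisation.\<close>

lemma edge_factorisation_restriction:
  assumes "edge_factorisation \<Lambda> es a" "g \<in> Arr G" "Cod \<Lambda> a = Dom G g"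
  shows "is_edge_restriction G \<Lambda> \<phi> g a (foldl (edge_restriction G \<Lambda> \<phi>) g es)"
  using assms
proof (induction arbitrary: g rule: edge_factorisation.induct)
  case (Nil v)
  then have v: "v = Dom G g" by (simp add: Cod_Ide)
  have c: "Cod G g \<in> Obj \<Lambda>" "Dom G g \<in> Obj \<Lambda>"
    using category.Cod_closed[OF category_G Nil(2)] category.Dom_closed[OF category_G Nil(2)] Obj_G
    by auto
  have "act \<phi> g (Ide \<Lambda> v \<cdot> b) = act \<phi> g (Ide \<Lambda> v) \<cdot> act \<phi> g b" if "b \<in> Arr \<Lambda>" "Cod \<Lambda> b = v" for b
    using Ide_Comp[of b] Ide_Comp[of "act \<phi> g b"] act_path[OF Nil(2) that(1)] that v
      act_Ide_path[OF Nil(2)] by simp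
  then show ?case
    using Nil v c act_Ide_path[OF Nil(2)]
    by (auto simp: is_edge_restriction_def paths_to_def Dom_Ide)
next
  case (Cons e es a)
  let ?h = "edge_restriction G \<Lambda> \<phi> g e" and ?k = "foldl (edge_restriction G \<Lambda> \<phi>) g (e # es)"
  have e: "e \<in> Arr \<Lambda>" using Cons by (auto simp: edges_def paths_of_deg_def)
  have a: "a \<in> Arr \<Lambda>" using Cons edge_factorisation_Arr by blast
  have eg: "Cod \<Lambda> e = Dom G g" using Cons e a by (simp add: Cod_Comp)
  have h: "is_edge_restriction G \<Lambda> \<phi> g e ?h"
    using edge_restriction[OF \<open>g \<in> Arr G\<close> \<open>e \<in> edges \<Lambda>\<close> eg] .
  have h': "?h \<in> Arr G" "Dom G ?h = Dom \<Lambda> e" "Cod G ?h = Dom \<Lambda> (act \<phi> g e)"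
    and h_act: "\<And>b. b \<in> Arr \<Lambda> \<Longrightarrow> Cod \<Lambda> b = Dom \<Lambda> e \<Longrightarrow> act \<phi> g (e \<cdot> b) = act \<phi> g e \<cdot> act \<phi> ?h b"
    using h by (auto simp: is_edge_restriction_def paths_to_def)
  have k: "is_edge_restriction G \<Lambda> \<phi> ?h a ?k"
    using Cons.IH[OF h'(1)] h'(2) Cons by simp
  have k': "?k \<in> Arr G" "Dom G ?k = Dom \<Lambda> a" "Cod G ?k = Dom \<Lambda> (act \<phi> ?h a)"
    and k_act: "\<And>b. b \<in> Arr \<Lambda> \<Longrightarrow> Cod \<Lambda> b = Dom \<Lambda> a \<Longrightarrow> act \<phi> ?h (a \<cdot> b) = act \<phi> ?h a \<cdot> act \<phi> ?k b"
    using k by (auto simp: is_edge_restriction_def paths_to_def)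
  note acte = act_path[OF \<open>g \<in> Arr G\<close> e eg]
  have acta: "act \<phi> ?h a \<in> Arr \<Lambda>" "Cod \<Lambda> (act \<phi> ?h a) = Dom \<Lambda> (act \<phi> g e)"
    using act_path[OF h'(1) a] h' Cons by auto
  have ea: "act \<phi> g (e \<cdot> a) = act \<phi> g e \<cdot> act \<phi> ?h a"
    using h_act a Cons by simp
  have "act \<phi> g ((e \<cdot> a) \<cdot> b) = act \<phi> g (e \<cdot> a) \<cdot> act \<phi> ?k b"
    if b: "b \<in> Arr \<Lambda>" "Cod \<Lambda> b = Dom \<Lambda> a" for b
  proof -
    have "act \<phi> g ((e \<cdot> a) \<cdot> b) = act \<phi> g (e \<cdot> (a \<cdot> b))"
      using e a b Cons by (simp add: Comp_assoc)
    also have "\<dots> = act \<phi> g e \<cdot> (act \<phi> ?h a \<cdot> act \<phi> ?k b)"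
      using h_act[of "a \<cdot> b"] k_act[OF b] e a b Cons by (simp add: Comp_closed Cod_Comp)
    also have "\<dots> = act \<phi> g (e \<cdot> a) \<cdot> act \<phi> ?k b"
      using acte acta act_path[OF k'(1) b(1)] b k' ea by (simp add: Comp_assoc)
    finally show ?thesis .
  qed
  moreover have "Dom \<Lambda> (e \<cdot> a) = Dom \<Lambda> a" "Dom \<Lambda> (act \<phi> g (e \<cdot> a)) = Dom \<Lambda> (act \<phi> ?h a)"
    using e a Cons ea acte acta by (simp_all add: Dom_Comp)
  ultimately show ?case
    using k' by (simp add: is_edge_restriction_def paths_to_def)
qed

lemma ex_edge_factorisation:
  assumes "a \<in> Arr \<Lambda>"
  shows "\<exists>es. edge_factorisation \<Lambda> es a"
  using assms
proof (induction "\<Sum>i\<in>UNIV. deg \<Lambda> a i" arbitrary: a rule: less_induct)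
  case less
  show ?case
  proof (cases "deg \<Lambda> a = 0")
    case True
    then have "a = Ide \<Lambda> (Cod \<Lambda> a)" using deg_zero_Ide less by blast
    then show ?thesis
      using edge_factorisation.Nil[of "Cod \<Lambda> a" \<Lambda>] Cod_closed less by metis
  next
    case False
    then obtain i where i: "deg \<Lambda> a i \<noteq> 0" by (auto simp: fun_eq_iff)
    then have "deg \<Lambda> a = unit_deg i + (deg \<Lambda> a - unit_deg i)"
      by (auto simp: fun_eq_iff unit_deg_def)
    then obtain e b where eb: "e \<in> Arr \<Lambda>" "b \<in> Arr \<Lambda>" "Dom \<Lambda> e = Cod \<Lambda> b" "a = e \<cdot> b"
      "deg \<Lambda> e = unit_deg i" "deg \<Lambda> b = deg \<Lambda> a - unit_deg i"
      using factorise[OF less(2)] by metis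
    have "(\<Sum>j\<in>UNIV. deg \<Lambda> b j) < (\<Sum>j\<in>UNIV. deg \<Lambda> a j)"
      using i eb(6) by (intro sum_strict_mono_ex1) (auto simp: unit_deg_def intro!: exI[of _ i])
    then obtain es where "edge_factorisation \<Lambda> es b" using less eb(2) by blast
    then have "edge_factorisation \<Lambda> (e # es) a"
      using eb edge_factorisation.Cons[of e \<Lambda> es b] by (auto simp: edges_def paths_of_deg_def)
    then show ?thesis by blast
  qed
qed

lemma res_is_edge_restriction:
  assumes "g \<in> Arr G" "a \<in> Arr \<Lambda>" "Cod \<Lambda> a = Dom G g"
  shows "is_edge_restriction G \<Lambda> \<phi> g a (res g a)"
proof -
  have "\<exists>!h. \<exists>es. edge_factorisation \<Lambda> es a \<and> h = foldl (edge_restriction G \<Lambda> \<phi>) g es"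
    using ex_edge_factorisation[OF assms(2)] edge_factorisation_restriction[OF _ assms(1,3)]
      is_edge_restriction_unique[OF assms] by metis
  from theI'[OF this] show ?thesis
    unfolding path_restriction_def
    using edge_factorisation_restriction[OF _ assms(1,3)] by metis
qed

lemma
  assumes "g \<in> Arr G" "a \<in> Arr \<Lambda>" "Cod \<Lambda> a = Dom G g"
  shows res_Arr: "res g a \<in> Arr G" and Dom_res: "Dom G (res g a) = Dom \<Lambda> a"
    and Cod_res: "Cod G (res g a) = Dom \<Lambda> (act \<phi> g a)"
    and act_Comp_path: "b \<in> Arr \<Lambda> \<Longrightarrow> Cod \<Lambda> b = Dom \<Lambda> a \<Longrightarrow> act \<phi> g (a \<cdot> b) = act \<phi> g a \<cdot> act \<phi> (res g a) b"
  using res_is_edge_restriction[OF assms] by (auto simp: is_edge_restriction_def paths_to_def)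

lemma res_eqI:
  assumes "g \<in> Arr G" "a \<in> Arr \<Lambda>" "Cod \<Lambda> a = Dom G g"
    and "h \<in> Arr G" "Dom G h = Dom \<Lambda> a" "Cod G h = Dom \<Lambda> (act \<phi> g a)"
    and "\<And>b. b \<in> Arr \<Lambda> \<Longrightarrow> Cod \<Lambda> b = Dom \<Lambda> a \<Longrightarrow> act \<phi> g (a \<cdot> b) = act \<phi> g a \<cdot> act \<phi> h b"
  shows "res g a = h"
  using assms
  by (intro is_edge_restriction_unique[OF assms(1-3)] res_is_edge_restriction)
    (auto simp: is_edge_restriction_def paths_to_def)

text \<open>Acting on \<open>a \<cdot> b \<cdot> c\<close> one factor at a time shows that the
  iterated restriction has the property characterising \<open>res g (a \<cdot> b)\<close>.\<close>

lemma res_Comp: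
  assumes g: "g \<in> Arr G" and a: "a \<in> Arr \<Lambda>" "Cod \<Lambda> a = Dom G g"
    and b: "b \<in> Arr \<Lambda>" "Cod \<Lambda> b = Dom \<Lambda> a"
  shows "res g (a \<cdot> b) = res (res g a) b"
proof -
  note h = res_Arr[OF g a] Dom_res[OF g a] Cod_res[OF g a]
  have b': "Cod \<Lambda> b = Dom G (res g a)" using b h by simp
  note k = res_Arr[OF h(1) b(1) b'] Dom_res[OF h(1) b(1) b'] Cod_res[OF h(1) b(1) b']
  note acta = act_path[OF g a] and actb = act_path[OF h(1) b(1) b']
  note ab = act_Comp_path[OF g a b]
  show ?thesis
  proof (rule res_eqI)
    show "Cod G (res (res g a) b) = Dom \<Lambda> (act \<phi> g (a \<cdot> b))"
      using k ab acta actb h by (simp add: Dom_Comp)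
    fix c assume c: "c \<in> Arr \<Lambda>" "Cod \<Lambda> c = Dom \<Lambda> (a \<cdot> b)"
    then have c': "Cod \<Lambda> c = Dom \<Lambda> b" using a b by (simp add: Dom_Comp)
    have "act \<phi> g (a \<cdot> b \<cdot> c) = act \<phi> g (a \<cdot> (b \<cdot> c))"
      using a b c c' by (simp add: Comp_assoc)
    also have "\<dots> = act \<phi> g a \<cdot> (act \<phi> (res g a) b \<cdot> act \<phi> (res (res g a) b) c)"
      using act_Comp_path[OF g a, of "b \<cdot> c"] act_Comp_path[OF h(1) b(1) b' c(1) c'] b c c'
      by (simp add: Comp_closed Cod_Comp)
    also have "\<dots> = act \<phi> g (a \<cdot> b) \<cdot> act \<phi> (res (res g a) b) c"
      using acta actb h k act_path[OF k(1) c(1)] c' ab by (simp add: Comp_assoc)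
    finally show "act \<phi> g (a \<cdot> b \<cdot> c) = act \<phi> g (a \<cdot> b) \<cdot> act \<phi> (res (res g a) b) c" .
  qed (use g a b k in \<open>auto simp: Comp_closed Cod_Comp Dom_Comp\<close>)
qed

lemma res_Ide_path:
  assumes g: "g \<in> Arr G"
  shows "res g (Ide \<Lambda> (Dom G g)) = g"
proof -
  have c: "Cod G g \<in> Obj \<Lambda>" "Dom G g \<in> Obj \<Lambda>"
    using category.Cod_closed[OF category_G g] category.Dom_closed[OF category_G g] Obj_G by auto
  have "act \<phi> g (Ide \<Lambda> (Dom G g) \<cdot> b) = act \<phi> g (Ide \<Lambda> (Dom G g)) \<cdot> act \<phi> g b"
    if "b \<in> Arr \<Lambda>" "Cod \<Lambda> b = Dom G g" for b
    using Ide_Comp[of b] Ide_Comp[of "act \<phi> g b"] act_path[OF g that] that act_Ide_path[OF g]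
    by simp
  then show ?thesis
    using c g by (intro res_eqI) (auto simp: Ide_closed Cod_Ide Dom_Ide act_Ide_path)
qed

lemma res_Ide:
  assumes "a \<in> Arr \<Lambda>"
  shows "res (Ide G (Cod \<Lambda> a)) a = Ide G (Dom \<Lambda> a)"
proof -
  have ob: "Cod \<Lambda> a \<in> Obj G" "Dom \<Lambda> a \<in> Obj G"
    using assms by (auto simp: Cod_closed Dom_closed Obj_G)
  have "act \<phi> (Ide G (Cod \<Lambda> a)) (a \<cdot> b) = act \<phi> (Ide G (Cod \<Lambda> a)) a \<cdot> act \<phi> (Ide G (Dom \<Lambda> a)) b"
    if b: "b \<in> Arr \<Lambda>" "Cod \<Lambda> b = Dom \<Lambda> a" for b
    using act_Ide[of "a \<cdot> b"] act_Ide[OF assms] act_Ide[OF b(1)] assms b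
    by (simp add: Comp_closed Cod_Comp)
  then show ?thesis
    using ob assms category.Ide_closed[OF category_G] category.Dom_Ide[OF category_G]
      category.Cod_Ide[OF category_G] act_Ide[OF assms]
    by (intro res_eqI) auto
qed

section \<open>The action on infinite paths\<close>

lemma iact_apply: "p \<le> q \<Longrightarrow> iact g x (p, q) = act \<phi> (res g (x (0, p))) (x (p, q))"
  by (simp add: act_inf_def Omega_def)

lemma iact_path:
  assumes g: "g \<in> Arr G" and x: "x \<in> inf_paths_to \<Lambda> (Dom G g)"
  shows "iact g x \<in> inf_paths \<Lambda>"
proof -
  have xi: "x \<in> inf_paths \<Lambda>" using x by (simp add: inf_paths_to_def)
  have c: "Cod \<Lambda> (x (0, p)) = Dom G g" for p
    using x inf_range_0 by (auto simp: inf_paths_to_def)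
  have xA: "x (0, p) \<in> Arr \<Lambda>" for p using inf_path_0_Arr[OF xi] .
  note r = res_Arr[OF g xA c] Dom_res[OF g xA c] Cod_res[OF g xA c]
  have xD: "Dom \<Lambda> (x (0, p)) = Cod \<Lambda> (x (p, q))" if "p \<le> q" for p q
    using inf_path_Dom_Cod[OF xi] that by simp
  have xpq: "x (p, q) \<in> Arr \<Lambda>" "Cod \<Lambda> (x (p, q)) = Dom G (res g (x (0, p)))" if "p \<le> q" for p q
    using inf_path_Arr[OF xi that] r xD[OF that] by auto
  \<comment> \<open>The element moving segments that start at \<open>q\<close> is the restriction,
    at \<open>x (p, q)\<close>, of the one moving segments that start at \<open>p\<close>; this is
    what makes consecutive image segments composable.\<close>
  have rr: "res (res g (x (0, p))) (x (p, q)) = res g (x (0, q))" if "p \<le> q" for p q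
    using res_Comp[OF g xA c xpq(1)[OF that], of p] xD[OF that] inf_path_Comp[OF xi _ that, of 0]
    by simp
  note actx = act_path[OF r(1) xpq]
  show ?thesis
  proof (rule inf_pathsI)
    fix p q t :: "'k \<Rightarrow> nat" assume le: "p \<le> q"
    show "iact g x (p, q) \<in> Arr \<Lambda>" "deg \<Lambda> (iact g x (p, q)) = q - p"
      using actx[OF le le] inf_path_deg[OF xi le] by (simp_all add: iact_apply le)
    assume le': "q \<le> t"
    then have le'': "p \<le> t" using le by simp
    show "Dom \<Lambda> (iact g x (p, q)) = Cod \<Lambda> (iact g x (q, t))"
      using actx(2)[OF le' le'] Cod_res[OF r(1) xpq[OF le]] rr[OF le] by (simp add: iact_apply le le')
    show "iact g x (p, q) \<cdot> iact g x (q, t) = iact g x (p, t)"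
      using act_Comp_path[OF r(1) xpq(1)[OF le] xpq(2)[OF le] xpq(1)[OF le']] rr[OF le]
        inf_path_Dom_Cod[OF xi le le'] inf_path_Comp[OF xi le le']
      by (simp add: iact_apply le le' le'')
  qed (simp add: act_inf_def Omega_def)
qed

text \<open>Restricting at a vertex changes nothing, so on initial segments the action is that of
  \<open>g\<close> itself.\<close>

lemma iact_0:
  assumes "g \<in> Arr G" "x \<in> inf_paths_to \<Lambda> (Dom G g)"
  shows "iact g x (0, n) = act \<phi> g (x (0, n))"
proof -
  have "x (0, 0) = Ide \<Lambda> (Dom G g)"
    using assms deg_zero_Ide[of "x (0, 0)"] inf_path_0_Arr[of x] inf_path_0_deg[of x 0]
    by (simp add: inf_paths_to_def inf_range_def)
  then show ?thesis using res_Ide_path[OF assms(1)] by (simp add: iact_apply)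
qed

lemma iact_range:
  assumes "g \<in> Arr G" "x \<in> inf_paths_to \<Lambda> (Dom G g)"
  shows "iact g x \<in> inf_paths_to \<Lambda> (Cod G g)"
  using iact_path[OF assms] iact_0[OF assms, of 0] act_path[OF assms(1), of "x (0, 0)"] assms(2)
  by (simp add: inf_paths_to_def inf_range_def inf_path_0_Arr)

lemma inf_paths_to_0:
  assumes "x \<in> inf_paths_to \<Lambda> v"
  shows "x (0, n) \<in> Arr \<Lambda>" "Cod \<Lambda> (x (0, n)) = v"
  using assms inf_range_0 by (auto simp: inf_paths_to_def inf_path_0_Arr)

text \<open>Makes \<open>iact g\<close> surjective onto the infinite paths with range
  \<open>Cod G g\<close>.\<close>

lemma inverse_arrow_inf:
  assumes "g \<in> Arr G"
  obtains h where "h \<in> Arr G" "Dom G h = Cod G g" "Cod G h = Dom G g"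
    "\<And>x. x \<in> inf_paths_to \<Lambda> (Cod G g) \<Longrightarrow> iact g (iact h x) = x"
proof -
  obtain h where h: "h \<in> Arr G" "Dom G h = Cod G g" "Cod G h = Dom G g"
    "\<And>a. a \<in> Arr \<Lambda> \<Longrightarrow> Cod \<Lambda> a = Cod G g \<Longrightarrow> act \<phi> g (act \<phi> h a) = a"
    using inverse_arrow[OF assms] by metis
  show ?thesis
  proof (rule that[OF h(1-3)])
    fix x assume x: "x \<in> inf_paths_to \<Lambda> (Cod G g)"
    have hx: "iact h x \<in> inf_paths_to \<Lambda> (Dom G g)" using iact_range[of h x] h x by simp
    show "iact g (iact h x) = x"
    proof (rule inf_path_eqI)
      show "iact g (iact h x) \<in> inf_paths \<Lambda>" using iact_path[OF assms hx] .
      show "x \<in> inf_paths \<Lambda>" using x by (simp add: inf_paths_to_def)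
      show "iact g (iact h x) (0, n) = x (0, n)" for n
        using iact_0[OF assms hx] iact_0[of h x n] h(1-3) h(4)[OF inf_paths_to_0[OF x]] x by simp
    qed
  qed
qed

lemma iact_concat:
  assumes g: "g \<in> Arr G" and a: "a \<in> Arr \<Lambda>" "Cod \<Lambda> a = Dom G g"
    and y: "y \<in> inf_paths_to \<Lambda> (Dom \<Lambda> a)"
  shows "iact g (concat_inf \<Lambda> a y) = concat_inf \<Lambda> (act \<phi> g a) (iact (res g a) y)"
proof -
  let ?x = "concat_inf \<Lambda> a y"
  note r = res_Arr[OF g a] Dom_res[OF g a] Cod_res[OF g a]
  have x: "?x \<in> inf_paths_to \<Lambda> (Dom G g)"
    using concat_inf_range[OF a(1) y] a by simp
  have y': "y \<in> inf_paths_to \<Lambda> (Dom G (res g a))" using y r by simp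
  note acta = act_path[OF g a]
  have z: "iact (res g a) y \<in> inf_paths_to \<Lambda> (Dom \<Lambda> (act \<phi> g a))"
    using iact_range[OF r(1) y'] r by simp
  have gx: "iact g ?x (0, deg \<Lambda> a) = act \<phi> g a"
    using iact_0[OF g x] concat_inf_prefix[OF a(1) y] by simp
  have "shift (deg \<Lambda> a) (iact g ?x) = iact (res g a) y"
  proof (rule inf_path_eqI)
    fix n
    have "act \<phi> g a \<cdot> shift (deg \<Lambda> a) (iact g ?x) (0, n) = act \<phi> g (a \<cdot> y (0, n))"
      using inf_path_0_add[OF iact_path[OF g x], of "deg \<Lambda> a" n] iact_0[OF g x] gx
        concat_inf_0_add[OF a(1) y] by simp
    also have "\<dots> = act \<phi> g a \<cdot> iact (res g a) y (0, n)"
      using act_Comp_path[OF g a inf_paths_to_0[OF y]] iact_0[OF r(1) y'] by simp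
    finally show "shift (deg \<Lambda> a) (iact g ?x) (0, n) = iact (res g a) y (0, n)"
      using acta inf_paths_to_0[OF z, of n] inf_range_shift[OF iact_path[OF g x], of "deg \<Lambda> a"] gx
        inf_range_0[OF shift_inf_path[OF iact_path[OF g x]], of "deg \<Lambda> a" n]
        inf_path_0_Arr[OF shift_inf_path[OF iact_path[OF g x]], of "deg \<Lambda> a" n]
      by (intro cancel(2)[of "act \<phi> g a" "shift (deg \<Lambda> a) (iact g ?x) (0, n)" "act \<phi> g a"
            "iact (res g a) y (0, n)"]) auto
  qed (use iact_path[OF g x] z in \<open>auto simp: inf_paths_to_def intro: shift_inf_path\<close>)
  then show ?thesis
    using concat_inf_eqI(2)[OF iact_path[OF g x], of "act \<phi> g a"] gx acta by simp
qed

end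

section \<open>The Parry measure\<close>

locale parry_graph = strongly_connected_finite_kgraph \<Lambda>
  for \<Lambda> :: "('v, 'a, 'k::finite) kgraph" (structure) +
  fixes \<xi> :: "'v \<Rightarrow> real" and M :: "('a, 'k) inf_path measure"
  assumes eigenvector: "perron_frobenius_eigenvector \<Lambda> \<xi>"
    and parry: "parry_measure \<Lambda> \<xi> M"
begin

abbreviation wt :: "('k \<Rightarrow> nat) \<Rightarrow> real" where
  "wt n \<equiv> rho_power \<Lambda> (\<lambda>i. - int (n i))"

lemma finite_paths_of_deg: "finite (paths_of_deg \<Lambda> n)"
  using finite_graph by (simp add: finite_kgraph_def)

lemma finite_Obj: "finite (Obj \<Lambda>)"
proof (rule inj_on_finite)
  show "inj_on (Ide \<Lambda>) (Obj \<Lambda>)" by (metis Dom_Ide inj_onI)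
  show "Ide \<Lambda> ` Obj \<Lambda> \<subseteq> paths_of_deg \<Lambda> 0"
    by (auto simp: paths_of_deg_def Ide_closed deg_Ide)
qed (rule finite_paths_of_deg)

lemma \<xi>_pos: "v \<in> Obj \<Lambda> \<Longrightarrow> \<xi> v > 0"
  using eigenvector by (simp add: perron_frobenius_eigenvector_def)

lemma \<xi>_le_1: "v \<in> Obj \<Lambda> \<Longrightarrow> \<xi> v \<le> 1"
  using eigenvector member_le_sum[of v "Obj \<Lambda>" "\<lambda>v. \<bar>\<xi> v\<bar>"] finite_Obj
  by (simp add: perron_frobenius_eigenvector_def)

text \<open>Read at the range of an edge of degree \<open>unit_deg i\<close>, the eigenvector
  equation has a positive term on one side and a positive multiple of the eigenvalue on the
  other.\<close>

lemma rho_pos: "rho \<Lambda> i > 0"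
proof -
  obtain e where e: "e \<in> paths_of_deg \<Lambda> (unit_deg i)" using edges_nonempty by blast
  then have ob: "Cod \<Lambda> e \<in> Obj \<Lambda>" "Dom \<Lambda> e \<in> Obj \<Lambda>"
    by (auto simp: paths_of_deg_def Cod_closed Dom_closed)
  have "edge_count \<Lambda> i (Cod \<Lambda> e) (Dom \<Lambda> e) > 0"
    using e finite_paths_of_deg[of "unit_deg i"]
    by (auto simp: edge_count_def card_gt_0_iff paths_to_def paths_from_def paths_of_deg_def)
  then have "0 < real (edge_count \<Lambda> i (Cod \<Lambda> e) (Dom \<Lambda> e)) * \<xi> (Dom \<Lambda> e)"
    using \<xi>_pos ob by simp
  also have "\<dots> \<le> (\<Sum>w\<in>Obj \<Lambda>. real (edge_count \<Lambda> i (Cod \<Lambda> e) w) * \<xi> w)"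
    using ob finite_Obj less_imp_le[OF \<xi>_pos] by (intro member_le_sum) auto
  also have "\<dots> = rho \<Lambda> i * \<xi> (Cod \<Lambda> e)"
    using eigenvector ob by (simp add: perron_frobenius_eigenvector_def)
  finally show ?thesis using \<xi>_pos[OF ob(1)] by (simp add: zero_less_mult_iff)
qed

lemma wt_pos: "wt n > 0"
  unfolding rho_power_def using rho_pos by (intro prod_pos) simp

lemma wt_add: "wt (p + q) = wt p * wt q"
proof -
  have "rho \<Lambda> i \<noteq> 0" for i using rho_pos[of i] by simp
  then have "rho \<Lambda> i powi (- int ((p + q) i)) = rho \<Lambda> i powi (- int (p i)) * rho \<Lambda> i powi (- int (q i))" for i
    by (simp add: power_int_add[symmetric])
  then show ?thesis
    unfolding rho_power_def by (simp add: prod.distrib)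
qed

lemma measure_cylinder: "a \<in> Arr \<Lambda> \<Longrightarrow> measure M (cylinder \<Lambda> a) = wt (deg \<Lambda> a) * \<xi> (Dom \<Lambda> a)"
  using parry unfolding parry_measure_def by blast

lemma finite_measure_M: "finite_measure M"
proof (rule finite_measureI)
  have "emeasure M (space M) = 1" using parry unfolding parry_measure_def by blast
  then show "emeasure M (space M) \<noteq> \<infinity>" by simp
qed

lemma cylinder_sets: "a \<in> Arr \<Lambda> \<Longrightarrow> cylinder \<Lambda> a \<in> sets M"
proof -
  assume "a \<in> Arr \<Lambda>"
  then have "openin (inf_path_topology \<Lambda>) (cylinder \<Lambda> a)"
    unfolding inf_path_topology_def by (intro topology_generated_by_Basis) auto
  then show ?thesis using parry by (auto simp: parry_measure_def)
qed

text \<open>No infinite extension has to be built by hand: the Parry measure gives every cylinder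
  positive mass, so none is empty.\<close>

lemma ex_inf_path:
  assumes "a \<in> Arr \<Lambda>"
  obtains x where "x \<in> inf_paths \<Lambda>" "x (0, deg \<Lambda> a) = a"
proof -
  have "measure M (cylinder \<Lambda> a) \<noteq> 0"
    using measure_cylinder[OF assms] wt_pos[of "deg \<Lambda> a"] \<xi>_pos[OF Dom_closed[OF assms]] by simp
  then have "cylinder \<Lambda> a \<noteq> {}" by auto
  then show ?thesis using cylinder_eq[OF assms] that by blast
qed

lemma ex_inf_path_to:
  assumes "v \<in> Obj \<Lambda>"
  obtains x where "x \<in> inf_paths_to \<Lambda> v"
proof -
  obtain x where "x \<in> inf_paths \<Lambda>" "x (0, 0) = Ide \<Lambda> v"
    using ex_inf_path[OF Ide_closed[OF assms]] assms by (auto simp: deg_Ide)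
  then show ?thesis
    using assms by (intro that[of x]) (auto simp: inf_paths_to_def inf_range_def Cod_Ide)
qed

text \<open>A truncation of an infinite path through \<open>a\<close> is an extension of any
  prescribed larger degree.\<close>

lemma ex_extension:
  assumes "a \<in> Arr \<Lambda>" "deg \<Lambda> a \<le> n"
  obtains b where "b \<in> Arr \<Lambda>" "deg \<Lambda> b = n" "b \<in> extensions \<Lambda> a"
  using ex_inf_path[OF assms(1)] inf_path_extensions[OF _ assms(2)] inf_path_0_Arr inf_path_0_deg
  by metis

lemma union_cylinder_sets:
  assumes "E \<subseteq> paths_of_deg \<Lambda> n"
  shows "(\<Union>a\<in>E. cylinder \<Lambda> a) \<in> sets M"
  using assms finite_subset[OF assms finite_paths_of_deg]
  by (intro sets.finite_UN cylinder_sets) (auto simp: paths_of_deg_def)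

lemma measure_union_cylinder:
  assumes "E \<subseteq> paths_of_deg \<Lambda> n"
  shows "measure M (\<Union>a\<in>E. cylinder \<Lambda> a) = wt n * (\<Sum>a\<in>E. \<xi> (Dom \<Lambda> a))"
proof -
  have E: "a \<in> Arr \<Lambda>" "deg \<Lambda> a = n" if "a \<in> E" for a
    using assms that by (auto simp: paths_of_deg_def)
  have "disjoint_family_on (cylinder \<Lambda>) E"
    unfolding disjoint_family_on_def using E cylinder_disjoint by metis
  then have "measure M (\<Union>a\<in>E. cylinder \<Lambda> a) = (\<Sum>a\<in>E. measure M (cylinder \<Lambda> a))"
    using E finite_subset[OF assms finite_paths_of_deg] cylinder_sets
    by (intro finite_measure.finite_measure_finite_Union[OF finite_measure_M]) auto
  also have "\<dots> = wt n * (\<Sum>a\<in>E. \<xi> (Dom \<Lambda> a))"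
    unfolding sum_distrib_left using E measure_cylinder by (intro sum.cong) auto
  finally show ?thesis .
qed

lemma union_cylinder_eq:
  assumes "E \<subseteq> paths_of_deg \<Lambda> n"
  shows "(\<Union>a\<in>E. cylinder \<Lambda> a) = {x \<in> inf_paths \<Lambda>. x (0, n) \<in> E}"
proof -
  have "cylinder \<Lambda> a = {x \<in> inf_paths \<Lambda>. x (0, n) = a}" if "a \<in> E" for a
    using assms that cylinder_eq[of a] by (auto simp: paths_of_deg_def)
  then show ?thesis by auto
qed

text \<open>
  Every path in \<open>E t\<close> loses, after \<open>L\<close> further diagonal steps, a fixed proportion of its cylinder;
  hence the measures decay geometrically.
\<close>

lemma measure_decay:
  fixes b :: "'k \<Rightarrow> nat" and L :: nat
  assumes E: "\<And>t. E t \<subseteq> paths_of_deg \<Lambda> (b + (\<lambda>_. t))"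
    and prefix: "\<And>s t a. s \<le> t \<Longrightarrow> a \<in> E t \<Longrightarrow> \<exists>c\<in>E s. a \<in> extensions \<Lambda> c"
    and escape: "\<And>t c. c \<in> E t \<Longrightarrow> \<exists>d\<in>Arr \<Lambda>. deg \<Lambda> d = (\<lambda>_. L) \<and> Cod \<Lambda> d = Dom \<Lambda> c \<and> c \<cdot> d \<notin> E (t + L)"
    and L: "L > 0"
  shows "(\<lambda>t. measure M (\<Union>a\<in>E t. cylinder \<Lambda> a)) \<longlonglongrightarrow> 0"
proof -
  interpret finite_measure M by (rule finite_measure_M)
  define U where "U t = (\<Union>a\<in>E t. cylinder \<Lambda> a)" for t
  have U_eq: "U t = {x \<in> inf_paths \<Lambda>. x (0, b + (\<lambda>_. t)) \<in> E t}" for t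
    unfolding U_def by (rule union_cylinder_eq[OF E])
  have U_sets: "U t \<in> sets M" for t
    unfolding U_def by (rule union_cylinder_sets[OF E])
  have EA: "a \<in> Arr \<Lambda>" "deg \<Lambda> a = b + (\<lambda>_. t)" if "a \<in> E t" for a t
    using E that by (auto simp: paths_of_deg_def)
  have U_mono: "U t \<subseteq> U s" if st: "s \<le> t" for s t
  proof
    fix x assume "x \<in> U t"
    then have x: "x \<in> inf_paths \<Lambda>" "x (0, b + (\<lambda>_. t)) \<in> E t" by (auto simp: U_eq)
    obtain c where c: "c \<in> E s" "x (0, b + (\<lambda>_. t)) \<in> extensions \<Lambda> c"
      using prefix[OF st x(2)] by blast
    have "x (0, b + (\<lambda>_. s)) = c"
      using inf_path_prefix_eq[OF x(1) c(2)] EA[OF c(1)] st by (simp add: le_fun_def)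
    then show "x \<in> U s" using x c by (simp add: U_eq)
  qed
  have ne: "Obj \<Lambda> \<noteq> {}"
    using edges_nonempty Dom_closed by (auto simp: paths_of_deg_def)
  define c where "c = Min (\<xi> ` Obj \<Lambda>)"
  have c_pos: "c > 0" and c_le: "\<And>v. v \<in> Obj \<Lambda> \<Longrightarrow> c \<le> \<xi> v"
    using finite_Obj \<xi>_pos ne by (auto simp: c_def)
  \<comment> \<open>Extending \<open>a\<close> by an escaping \<open>d\<close> keeps the share
    \<open>wt (\<lambda>_. L) * \<xi> (Dom \<Lambda> d) / \<xi> (Dom \<Lambda> a)\<close> of its
    cylinder, which is at least \<open>wt (\<lambda>_. L) * c\<close> because \<xi> \<le> 1. The
    maximum with 0 guarantees a nonnegative ratio for the iteration.\<close>
  define r where "r = max 0 (1 - wt (\<lambda>_. L) * c)"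
  have r: "0 \<le> r" "r < 1" using c_pos wt_pos[of "\<lambda>_. L"] by (auto simp: r_def)
  have step: "measure M (U (t + L)) \<le> r * measure M (U t)" for t
  proof -
    have "\<forall>a\<in>E t. \<exists>d. d \<in> Arr \<Lambda> \<and> deg \<Lambda> d = (\<lambda>_. L) \<and> Cod \<Lambda> d = Dom \<Lambda> a \<and> a \<cdot> d \<notin> E (t + L)"
      using escape by blast
    from bchoice[OF this] obtain e where e: "\<And>a. a \<in> E t \<Longrightarrow>
        e a \<in> Arr \<Lambda> \<and> deg \<Lambda> (e a) = (\<lambda>_. L) \<and> Cod \<Lambda> (e a) = Dom \<Lambda> a \<and> a \<cdot> e a \<notin> E (t + L)"
      by blast
    \<comment> \<open>One escaping extension per member of \<open>E t\<close>. The members have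
      equal degree, so they are recovered as prefixes and the extensions are distinct.\<close>
    define F where "F = (\<lambda>a. a \<cdot> e a) ` E t"
    have e': "a \<cdot> e a \<in> Arr \<Lambda>" "Dom \<Lambda> (a \<cdot> e a) = Dom \<Lambda> (e a)"
      "deg \<Lambda> (a \<cdot> e a) = b + (\<lambda>_. t) + (\<lambda>_. L)" if "a \<in> E t" for a
      using e[OF that] EA[OF that] by (auto simp: Comp_closed Dom_Comp deg_Comp)
    have F: "F \<subseteq> paths_of_deg \<Lambda> (b + (\<lambda>_. t) + (\<lambda>_. L))"
      using e' by (auto simp: F_def paths_of_deg_def)
    have inj: "inj_on (\<lambda>a. a \<cdot> e a) (E t)"
    proof (rule inj_onI)
      fix a a' assume "a \<in> E t" "a' \<in> E t" "a \<cdot> e a = a' \<cdot> e a'"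
      then show "a = a'" using e EA cancel(1)[of a "e a" a' "e a'"] by auto
    qed
    define V where "V = (\<Union>a\<in>F. cylinder \<Lambda> a)"
    have V_sets: "V \<in> sets M" unfolding V_def by (rule union_cylinder_sets[OF F])
    have "V \<subseteq> U t"
      unfolding V_def U_def F_def image_image
    proof (rule UN_mono[OF order_refl])
      fix a assume a: "a \<in> E t"
      show "cylinder \<Lambda> (a \<cdot> e a) \<subseteq> cylinder \<Lambda> a"
        using e[OF a] EA[OF a] by (intro cylinder_Comp) simp_all
    qed
    moreover have "U (t + L) \<inter> V = {}"
    proof -
      have "b + (\<lambda>_. t) + (\<lambda>_. L) = b + (\<lambda>_. t + L)" by (simp add: fun_eq_iff)
      moreover have "F \<inter> E (t + L) = {}" using e by (auto simp: F_def)
      ultimately show ?thesis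
        unfolding V_def union_cylinder_eq[OF F] U_eq by auto
    qed
    ultimately have "U (t + L) \<subseteq> U t - V" using U_mono[of t "t + L"] by auto
    then have "measure M (U (t + L)) \<le> measure M (U t - V)"
      using U_sets V_sets by (intro finite_measure_mono) auto
    also have "\<dots> = measure M (U t) - measure M V"
      using U_sets V_sets \<open>V \<subseteq> U t\<close> by (rule finite_measure_Diff)
    finally have 1: "measure M (U (t + L)) \<le> measure M (U t) - measure M V" .
    have "c * (\<Sum>a\<in>E t. \<xi> (Dom \<Lambda> a)) \<le> (\<Sum>a\<in>E t. \<xi> (Dom \<Lambda> (e a)))"
      unfolding sum_distrib_left
    proof (rule sum_mono)
      fix a assume a: "a \<in> E t"
      have "c * \<xi> (Dom \<Lambda> a) \<le> c"
        using \<xi>_le_1[OF Dom_closed] EA[OF a] c_pos by simp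
      also have "c \<le> \<xi> (Dom \<Lambda> (e a))" using e[OF a] c_le Dom_closed by blast
      finally show "c * \<xi> (Dom \<Lambda> a) \<le> \<xi> (Dom \<Lambda> (e a))" .
    qed
    also have "\<dots> = (\<Sum>a\<in>F. \<xi> (Dom \<Lambda> a))"
      unfolding F_def by (subst sum.reindex[OF inj]) (simp add: e')
    finally have "wt (b + (\<lambda>_. t) + (\<lambda>_. L)) * (c * (\<Sum>a\<in>E t. \<xi> (Dom \<Lambda> a))) \<le>
        wt (b + (\<lambda>_. t) + (\<lambda>_. L)) * (\<Sum>a\<in>F. \<xi> (Dom \<Lambda> a))"
      by (intro mult_left_mono less_imp_le[OF wt_pos])
    then have "(wt (\<lambda>_. L) * c) * measure M (U t) \<le> measure M V"
      unfolding V_def U_def measure_union_cylinder[OF F] measure_union_cylinder[OF E]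
        wt_add[of "b + (\<lambda>_. t)" "\<lambda>_. L"]
      by (simp only: mult_ac)
    with 1 have "measure M (U (t + L)) \<le> (1 - wt (\<lambda>_. L) * c) * measure M (U t)"
      by (simp add: algebra_simps)
    also have "\<dots> \<le> r * measure M (U t)"
      by (intro mult_right_mono) (auto simp: r_def)
    finally show ?thesis .
  qed
  have bound: "measure M (U (j * L)) \<le> r ^ j * measure M (U 0)" for j
  proof (induction j)
    case (Suc j)
    have "measure M (U (Suc j * L)) \<le> r * measure M (U (j * L))"
      using step[of "j * L"] by (simp add: add.commute)
    also have "\<dots> \<le> r * (r ^ j * measure M (U 0))"
      using Suc r by (intro mult_left_mono)
    finally show ?case by simp
  qed simp
  have "(\<lambda>j. r ^ j * measure M (U 0)) \<longlonglongrightarrow> 0"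
    using r by (intro tendsto_mult_left_zero LIMSEQ_realpow_zero)
  then have sub: "(\<lambda>j. measure M (U (j * L))) \<longlonglongrightarrow> 0"
    by (rule tendsto_sandwich[OF _ _ tendsto_const, rotated 2]) (auto simp: bound)
  \<comment> \<open>The geometric bound covers only multiples of \<open>L\<close>. Monotonicity
    gives the full sequence a limit, and the subsequence identifies it.\<close>
  have dec: "decseq (\<lambda>t. measure M (U t))"
    unfolding decseq_def by (intro allI impI finite_measure_mono U_mono U_sets)
  obtain u where u: "(\<lambda>t. measure M (U t)) \<longlonglongrightarrow> u"
    using decseq_convergent[OF dec, of 0] by auto
  have "strict_mono (\<lambda>j. j * L)" using L by (simp add: strict_mono_def)
  then have "(\<lambda>j. measure M (U (j * L))) \<longlonglongrightarrow> u"
    using LIMSEQ_subseq_LIMSEQ[OF u] by (simp add: comp_def)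
  then have "u = 0" using sub LIMSEQ_unique by blast
  then show ?thesis using u by (simp add: U_def)
qed

end

section \<open>Periodicity and the triple cylinders\<close>

locale parry_action = parry_graph \<Lambda> \<xi> M + self_similar \<Lambda> G \<phi>
  for \<Lambda> :: "('v, 'a, 'k::finite) kgraph" (structure)
    and \<xi> :: "'v \<Rightarrow> real" and M :: "('a, 'k) inf_path measure"
    and G :: "('v, 'g) category" and \<phi> :: "'g \<Rightarrow> 'v \<times> 'v \<times> ('a \<Rightarrow> 'a)" +
  assumes finite_states: "finite_state G \<Lambda> \<phi>"
begin

text \<open>For non-units this is \<open>finite_state\<close>. A unit restricts only to units, and
  these are indexed by the finitely many vertices.\<close>

lemma finite_res:
  assumes "g \<in> Arr G"
  shows "finite (res g ` paths_to \<Lambda> (Dom G g))"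
proof (cases "g \<in> Ide G ` Obj G")
  case True
  then obtain v where v: "v \<in> Obj G" "g = Ide G v" by blast
  have "res g a \<in> Ide G ` Obj \<Lambda>" if "a \<in> paths_to \<Lambda> (Dom G g)" for a
    using that v res_Ide[of a] category.Dom_Ide[OF category_G v(1)]
    by (auto simp: paths_to_def Dom_closed)
  then show ?thesis using finite_Obj by (meson finite_imageI finite_subset image_subsetI)
next
  case False
  then show ?thesis using finite_states assms by (simp add: finite_state_def)
qed

lemma ex_le_const:
  fixes f :: "'b \<Rightarrow> 'k \<Rightarrow> nat"
  assumes "finite P"
  obtains L :: nat where "L > 0" "\<And>x. x \<in> P \<Longrightarrow> f x \<le> (\<lambda>_. L)"
proof
  \<comment> \<open>The successor keeps the bound positive even if \<open>P\<close> is empty or all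
    its degrees vanish.\<close>
  let ?L = "Suc (\<Sum>x\<in>P. \<Sum>i\<in>UNIV. f x i)"
  show "f x \<le> (\<lambda>_. ?L)" if "x \<in> P" for x
  proof (rule le_funI)
    fix i
    have "f x i \<le> (\<Sum>i\<in>UNIV. f x i)" by (intro member_le_sum) auto
    also have "\<dots> \<le> (\<Sum>x\<in>P. \<Sum>i\<in>UNIV. f x i)"
      using assms that member_le_sum[of x P "\<lambda>x. \<Sum>i\<in>UNIV. f x i"] by simp
    finally show "f x i \<le> ?L" by simp
  qed
qed simp

text \<open>Each finite path is an initial segment of an infinite one, so faithfulness passes from
  finite to infinite paths.\<close>

lemma iact_eq_imp_eq:
  assumes "g \<in> Arr G" "h \<in> Arr G" "Dom G g = Dom G h" "Cod G g = Cod G h"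
    and "\<And>x. x \<in> inf_paths_to \<Lambda> (Dom G h) \<Longrightarrow> iact g x = iact h x"
  shows "g = h"
proof (rule arrow_eqI[OF assms(1-4)])
  fix a assume a: "a \<in> Arr \<Lambda>" "Cod \<Lambda> a = Dom G h"
  obtain x where x: "x \<in> inf_paths \<Lambda>" "x (0, deg \<Lambda> a) = a" using ex_inf_path[OF a(1)] by blast
  then have "x \<in> inf_paths_to \<Lambda> (Dom G h)"
    using inf_range_0[OF x(1), of "deg \<Lambda> a"] a by (simp add: inf_paths_to_def)
  then show "act \<phi> g a = act \<phi> h a"
    using iact_0[OF assms(1), of x "deg \<Lambda> a"] iact_0[OF assms(2), of x "deg \<Lambda> a"] assms(3,5) x
    by simp
qed

section \<open>Existence and uniqueness of the pair attached to a period\<close>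

abbreviation theta_h_pair :: "('k \<Rightarrow> nat) \<Rightarrow> 'a \<Rightarrow> 'a \<Rightarrow> 'g \<Rightarrow> bool" where
  "theta_h_pair q l m h \<equiv> m \<in> paths_of_deg \<Lambda> q \<and> h \<in> Arr G \<and> Cod G h = Dom \<Lambda> l \<and> Dom G h = Dom \<Lambda> m \<and>
    (\<forall>x \<in> inf_paths_to \<Lambda> (Dom G h). concat_inf \<Lambda> l (iact h x) = concat_inf \<Lambda> m x)"

text \<open>
  Any \<open>m' \<in> \<Lambda>\<^sup>q\<close> that shares a single infinite path with \<open>l\<close> is already \<open>\<theta>(l)\<close>, since the
  pair \<open>(m, h)\<close> covers all of the cylinder of \<open>l\<close>.
\<close>

lemma theta_h_pair_prefix:
  assumes l: "l \<in> Arr \<Lambda>" and mh: "theta_h_pair q l m h"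
    and m': "m' \<in> paths_of_deg \<Lambda> q" and y: "y \<in> inf_paths_to \<Lambda> (Dom \<Lambda> l)"
    and z: "z \<in> inf_paths_to \<Lambda> (Dom \<Lambda> m')" and eq: "concat_inf \<Lambda> l y = concat_inf \<Lambda> m' z"
  shows "m' = m"
proof -
  have h: "h \<in> Arr G" "Cod G h = Dom \<Lambda> l" "Dom G h = Dom \<Lambda> m" using mh by auto
  obtain k where k: "k \<in> Arr G" "Dom G k = Cod G h" "Cod G k = Dom G h"
    "\<And>x. x \<in> inf_paths_to \<Lambda> (Cod G h) \<Longrightarrow> iact h (iact k x) = x"
    using inverse_arrow_inf[OF h(1)] by metis
  have ky: "iact k y \<in> inf_paths_to \<Lambda> (Dom G h)" using iact_range[of k y] k y h by simp
  have "concat_inf \<Lambda> m (iact k y) = concat_inf \<Lambda> l (iact h (iact k y))" using mh ky by simp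
  also have "\<dots> = concat_inf \<Lambda> m' z" using k(4)[of y] y h eq by simp
  finally show "m' = m"
    using concat_inf_inject(1)[of m "iact k y" m' z] mh m' z ky h by (auto simp: paths_of_deg_def)
qed

lemma theta_h_pair_unique:
  assumes l: "l \<in> Arr \<Lambda>" and mh: "theta_h_pair q l m h" and mh': "theta_h_pair q l m' h'"
  shows "m' = m" "h' = h"
proof -
  have h': "h' \<in> Arr G" "Cod G h' = Dom \<Lambda> l" "Dom G h' = Dom \<Lambda> m'" "m' \<in> Arr \<Lambda>"
    and h: "h \<in> Arr G" "Cod G h = Dom \<Lambda> l" "Dom G h = Dom \<Lambda> m"
    using mh mh' by (auto simp: paths_of_deg_def)
  obtain z where z: "z \<in> inf_paths_to \<Lambda> (Dom \<Lambda> m')"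
    using ex_inf_path_to Dom_closed[OF h'(4)] by metis
  show "m' = m"
    by (rule theta_h_pair_prefix[OF l mh, of m' "iact h' z" z])
      (use mh' z h' iact_range[of h' z] in auto)
  show "h' = h"
  proof (rule iact_eq_imp_eq)
    fix x assume x: "x \<in> inf_paths_to \<Lambda> (Dom G h)"
    then have x': "x \<in> inf_paths_to \<Lambda> (Dom G h')" using h h' \<open>m' = m\<close> by simp
    have "concat_inf \<Lambda> l (iact h' x) = concat_inf \<Lambda> l (iact h x)"
      using mh mh' x x' \<open>m' = m\<close> by simp
    then show "iact h' x = iact h x"
      using concat_inf_inject(2)[of l "iact h' x" l "iact h x"] l h h'
        iact_range[OF h'(1) x'] iact_range[OF h(1) x] by simp
  qed (use h h' \<open>m' = m\<close> in auto)
qed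

text \<open>
  A period is realised at one vertex only; extending the given \<open>l\<close> to the left by a path into
  \<open>cod(g)\<close> transports it to \<open>s(l)\<close>.
\<close>

lemma ex_theta_h_pair:
  assumes per: "deg_diff (deg \<Lambda> l) q \<in> Per G \<Lambda> \<phi>" and l: "l \<in> Arr \<Lambda>"
  shows "\<exists>m h. theta_h_pair q l m h"
proof -
  let ?p = "deg \<Lambda> l"
  \<comment> \<open>Membership in \<open>Per\<close> depends only on the difference, so the degrees
    realising it may be others than those of interest; \<open>pq\<close> below is their relation in
    additive form.\<close>
  obtain p' q' g where dd: "deg_diff ?p q = deg_diff p' q'" and g: "g \<in> Arr G"
    and H: "\<And>x. x \<in> inf_paths_to \<Lambda> (Dom G g) \<Longrightarrow> shift p' x = shift q' (iact g x)"
    using per unfolding Per_def by blast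
  have pq: "?p i + q' i = q i + p' i" for i
    using fun_cong[OF dd, of i] by (simp add: deg_diff_def)
  have Cg: "Cod G g \<in> Obj \<Lambda>" using category.Cod_closed[OF category_G g] Obj_G by simp
  obtain x where x: "x \<in> inf_paths_to \<Lambda> (Cod G g)" using ex_inf_path_to[OF Cg] .
  define k1 where "k1 = x (0, q')"
  have k1: "k1 \<in> Arr \<Lambda>" "Cod \<Lambda> k1 = Cod G g" "deg \<Lambda> k1 = q'"
    using x inf_paths_to_0[OF x] by (auto simp: k1_def inf_paths_to_def inf_path_0_deg)
  have "paths_to \<Lambda> (Dom \<Lambda> k1) \<inter> paths_from \<Lambda> (Cod \<Lambda> l) \<noteq> {}"
    using connected_graph k1 l by (simp add: strongly_connected_def Dom_closed Cod_closed)
  then obtain c where "c \<in> paths_to \<Lambda> (Dom \<Lambda> k1) \<inter> paths_from \<Lambda> (Cod \<Lambda> l)" by blast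
  then have c: "c \<in> Arr \<Lambda>" "Dom \<Lambda> k1 = Cod \<Lambda> c" "Dom \<Lambda> c = Cod \<Lambda> l"
    by (auto simp: paths_to_def paths_from_def)
  have cl: "c \<cdot> l \<in> Arr \<Lambda>" "Cod \<Lambda> (c \<cdot> l) = Cod \<Lambda> c" "Dom \<Lambda> (c \<cdot> l) = Dom \<Lambda> l"
    "deg \<Lambda> (c \<cdot> l) = deg \<Lambda> c + ?p"
    using c l by (auto simp: Comp_closed Cod_Comp Dom_Comp deg_Comp)
  \<comment> \<open>The factor \<open>k1\<close> has degree \<open>q'\<close> and will be removed by
    the shift; \<open>c\<close>, supplied by strong connectivity, joins it to
    \<open>l\<close>.\<close>
  define k where "k = k1 \<cdot> (c \<cdot> l)"
  have k: "k \<in> Arr \<Lambda>" "Cod \<Lambda> k = Cod G g" "Dom \<Lambda> k = Dom \<Lambda> l" "deg \<Lambda> k = q' + (deg \<Lambda> c + ?p)"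
    using k1 c cl by (auto simp: k_def Comp_closed Cod_Comp Dom_Comp deg_Comp)
  obtain gi where gi: "gi \<in> Arr G" "Dom G gi = Cod G g" "Cod G gi = Dom G g"
    "\<And>a. a \<in> Arr \<Lambda> \<Longrightarrow> Cod \<Lambda> a = Cod G g \<Longrightarrow> act \<phi> g (act \<phi> gi a) = a"
    using inverse_arrow[OF g] by metis
  \<comment> \<open>Pulled back along \<open>g\<close>, so that \<open>g\<close> carries
    \<open>n\<close> to a path ending in \<open>l\<close> and the restriction of \<open>g\<close> at
    \<open>n\<close> has codomain \<open>Dom \<Lambda> l\<close>.\<close>
  define n where "n = act \<phi> gi k"
  have n: "n \<in> Arr \<Lambda>" "Cod \<Lambda> n = Dom G g" "act \<phi> g n = k" "deg \<Lambda> n = deg \<Lambda> k"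
    using act_path[OF gi(1) k(1)] gi k by (auto simp: n_def)
  \<comment> \<open>By \<open>pq\<close> the same degree can be split differently: a head of degree
    \<open>p'\<close> for the other shift, a piece as long as \<open>c\<close>, and a last piece of
    degree \<open>q\<close>, which becomes \<open>m\<close>.\<close>
  have "deg \<Lambda> n = p' + (deg \<Lambda> c + q)"
    using n(4) k(4) pq by (auto simp: fun_eq_iff) (metis add.commute)
  then obtain n1 n2 where n12: "n1 \<in> Arr \<Lambda>" "n2 \<in> Arr \<Lambda>" "Dom \<Lambda> n1 = Cod \<Lambda> n2" "n = n1 \<cdot> n2"
    "deg \<Lambda> n1 = p'" "deg \<Lambda> n2 = deg \<Lambda> c + q"
    using factorise[OF n(1)] by metis
  obtain c' m where m: "c' \<in> Arr \<Lambda>" "m \<in> Arr \<Lambda>" "Dom \<Lambda> c' = Cod \<Lambda> m" "n2 = c' \<cdot> m"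
    "deg \<Lambda> c' = deg \<Lambda> c" "deg \<Lambda> m = q"
    using factorise[OF n12(2,6)] by metis
  define h where "h = res g n"
  have Dn: "Dom \<Lambda> n = Dom \<Lambda> m" "Dom \<Lambda> n2 = Dom \<Lambda> m"
    using n12 m by (auto simp: Dom_Comp)
  have h: "h \<in> Arr G" "Dom G h = Dom \<Lambda> m" "Cod G h = Dom \<Lambda> l"
    using res_Arr[OF g n(1,2)] Dom_res[OF g n(1,2)] Cod_res[OF g n(1,2)] Dn n k
    by (auto simp: h_def)
  have "concat_inf \<Lambda> l (iact h z) = concat_inf \<Lambda> m z" if z: "z \<in> inf_paths_to \<Lambda> (Dom G h)" for z
  proof -
    have z': "z \<in> inf_paths_to \<Lambda> (Dom \<Lambda> m)" "z \<in> inf_paths_to \<Lambda> (Dom \<Lambda> n)"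
      "z \<in> inf_paths_to \<Lambda> (Dom \<Lambda> n2)"
      using z h Dn by auto
    have hz: "iact h z \<in> inf_paths_to \<Lambda> (Dom \<Lambda> l)" using iact_range[OF h(1) z] h by simp
    have mz: "concat_inf \<Lambda> m z \<in> inf_paths_to \<Lambda> (Dom \<Lambda> c')"
      using concat_inf_range[OF m(2) z'(1)] m by simp
    have lz: "concat_inf \<Lambda> l (iact h z) \<in> inf_paths_to \<Lambda> (Dom \<Lambda> c)"
      using concat_inf_range[OF l hz] c by simp
    have "concat_inf \<Lambda> n z = concat_inf \<Lambda> n1 (concat_inf \<Lambda> n2 z)"
      unfolding n12(4) using n12 z' by (intro concat_inf_Comp) auto
    moreover have "concat_inf \<Lambda> n2 z \<in> inf_paths_to \<Lambda> (Dom \<Lambda> n1)"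
      using concat_inf_range[OF n12(2) z'(3)] n12 by simp
    ultimately have L: "shift p' (concat_inf \<Lambda> n z) = concat_inf \<Lambda> n2 z"
      using shift_concat_inf[OF n12(1)] n12(5) by metis
    have "concat_inf \<Lambda> k (iact h z) = concat_inf \<Lambda> k1 (concat_inf \<Lambda> (c \<cdot> l) (iact h z))"
      unfolding k_def using k1 cl c hz by (intro concat_inf_Comp) auto
    moreover have "concat_inf \<Lambda> (c \<cdot> l) (iact h z) \<in> inf_paths_to \<Lambda> (Dom \<Lambda> k1)"
      using concat_inf_range[of "c \<cdot> l" "iact h z"] cl hz c by simp
    ultimately have R: "shift q' (concat_inf \<Lambda> k (iact h z)) = concat_inf \<Lambda> (c \<cdot> l) (iact h z)"
      using shift_concat_inf[OF k1(1)] k1(3) by metis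
    have "concat_inf \<Lambda> n z \<in> inf_paths_to \<Lambda> (Dom G g)"
      using concat_inf_range[OF n(1) z'(2)] n by simp
    then have "shift p' (concat_inf \<Lambda> n z) = shift q' (concat_inf \<Lambda> k (iact h z))"
      using H iact_concat[OF g n(1,2) z'(2)] n(3) by (simp add: h_def)
    \<comment> \<open>After the shifts, the equation compares a path beginning with
      \<open>c'\<close> and one beginning with \<open>c\<close>. These have equal degree, so they
      cancel and leave the required identity.\<close>
    then have "concat_inf \<Lambda> n2 z = concat_inf \<Lambda> (c \<cdot> l) (iact h z)" using L R by simp
    moreover have "concat_inf \<Lambda> n2 z = concat_inf \<Lambda> c' (concat_inf \<Lambda> m z)"
      unfolding m(4) using m z' by (intro concat_inf_Comp) auto
    moreover have "concat_inf \<Lambda> (c \<cdot> l) (iact h z) = concat_inf \<Lambda> c (concat_inf \<Lambda> l (iact h z))"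
      using c l hz by (intro concat_inf_Comp) auto
    ultimately show ?thesis
      using concat_inf_inject(2)[OF m(1) mz c(1) lz m(5)] by simp
  qed
  then have "theta_h_pair q l m h" using h m by (simp add: paths_of_deg_def)
  then show ?thesis by blast
qed

lemma theta_h_pair:
  assumes "deg_diff (deg \<Lambda> l) q \<in> Per G \<Lambda> \<phi>" "l \<in> Arr \<Lambda>"
  shows "theta_h_pair q l (theta G \<Lambda> \<phi> (deg \<Lambda> l) q l) (h_elt G \<Lambda> \<phi> (deg \<Lambda> l) q l)"
proof -
  obtain m h where mh: "theta_h_pair q l m h" using ex_theta_h_pair[OF assms] by blast
  have "theta_h G \<Lambda> \<phi> (deg \<Lambda> l) q l = (m, h)"
    unfolding theta_h_def
  proof (rule the_equality)
    fix u assume u: "case u of (m, h) \<Rightarrow> theta_h_pair q l m h"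
    obtain m' h' where u': "u = (m', h')" by (cases u)
    then have "theta_h_pair q l m' h'" using u by simp
    then show "u = (m, h)" using theta_h_pair_unique[OF assms(2) mh] u' by blast
  qed (use mh in simp)
  then show ?thesis using mh by (simp add: theta_def h_elt_def)
qed

text \<open>The witness \<open>y\<close> can only be the tail of \<open>x\<close> after
  \<open>m\<close>, so the existential quantifier disappears.\<close>

lemma triple_cylinder_eq:
  assumes "l \<in> Arr \<Lambda>" "m \<in> Arr \<Lambda>" "Dom \<Lambda> m = Dom G g"
  shows "triple_cylinder G \<Lambda> \<phi> l g m =
    {x \<in> inf_paths \<Lambda>. x (0, deg \<Lambda> m) = m \<and> concat_inf \<Lambda> l (iact g (shift (deg \<Lambda> m) x)) = x}"
proof (intro equalityI subsetI)
  fix x assume "x \<in> triple_cylinder G \<Lambda> \<phi> l g m"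
  then obtain y where y: "x \<in> inf_paths \<Lambda>" "y \<in> inf_paths_to \<Lambda> (Dom \<Lambda> m)"
    "x = concat_inf \<Lambda> l (iact g y)" "x = concat_inf \<Lambda> m y"
    unfolding triple_cylinder_def assms(3) by blast
  then show "x \<in> {x \<in> inf_paths \<Lambda>. x (0, deg \<Lambda> m) = m \<and> concat_inf \<Lambda> l (iact g (shift (deg \<Lambda> m) x)) = x}"
    using concat_inf[OF assms(2) y(2)] by simp
next
  fix x assume x: "x \<in> {x \<in> inf_paths \<Lambda>. x (0, deg \<Lambda> m) = m \<and> concat_inf \<Lambda> l (iact g (shift (deg \<Lambda> m) x)) = x}"
  then have "shift (deg \<Lambda> m) x \<in> inf_paths_to \<Lambda> (Dom G g)" "concat_inf \<Lambda> m (shift (deg \<Lambda> m) x) = x"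
    using concat_inf_eqI[of x m] assms(3) by auto
  then show "x \<in> triple_cylinder G \<Lambda> \<phi> l g m"
    using x unfolding triple_cylinder_def by (auto intro!: bexI[of _ "shift (deg \<Lambda> m) x"])
qed

lemma measure_triple_cylinder_theta_h:
  assumes l: "l \<in> Arr \<Lambda>" and m: "m \<in> Arr \<Lambda>" and mh: "theta_h_pair (deg \<Lambda> m) l m h"
  shows "measure M (triple_cylinder G \<Lambda> \<phi> l h m) = wt (deg \<Lambda> m) * \<xi> (Dom \<Lambda> m)"
proof -
  have "triple_cylinder G \<Lambda> \<phi> l h m = cylinder \<Lambda> m"
  proof (intro equalityI subsetI)
    fix x assume "x \<in> cylinder \<Lambda> m"
    then have x: "x \<in> inf_paths \<Lambda>" "x (0, deg \<Lambda> m) = m" by (auto simp: cylinder_eq[OF m])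
    then show "x \<in> triple_cylinder G \<Lambda> \<phi> l h m"
      using concat_inf_eqI[OF x] mh triple_cylinder_eq[OF l m, of h] by auto
  qed (use mh triple_cylinder_eq[OF l m, of h] cylinder_eq[OF m] in auto)
  then show ?thesis using measure_cylinder[OF m] by simp
qed

text \<open>A single point of the set would be an infinite path beginning with \<open>l\<close> and
  with \<open>m\<close>, which already forces \<open>m = m'\<close>.\<close>

lemma triple_cylinder_not_theta:
  assumes l: "l \<in> Arr \<Lambda>" and m: "m \<in> Arr \<Lambda>" and g: "g \<in> Arr G" "Dom \<Lambda> l = Cod G g" "Dom \<Lambda> m = Dom G g"
    and mh: "theta_h_pair (deg \<Lambda> m) l m' h" and "m \<noteq> m'"
  shows "triple_cylinder G \<Lambda> \<phi> l g m = {}"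
proof -
  have False if y: "y \<in> inf_paths_to \<Lambda> (Dom G g)" "concat_inf \<Lambda> l (iact g y) = concat_inf \<Lambda> m y" for y
    using theta_h_pair_prefix[OF l mh, of m "iact g y" y] iact_range[OF g(1) y(1)] y g m \<open>m \<noteq> m'\<close>
    by (auto simp: paths_of_deg_def)
  then show ?thesis by (auto simp: triple_cylinder_def)
qed

section \<open>Infinite paths on which two groupoid elements agree\<close>

lemma cylinder_family_subset:
  assumes "m \<in> Arr \<Lambda>" and "\<And>n. n \<in> S \<Longrightarrow> n \<in> Arr \<Lambda> \<and> Cod \<Lambda> n = Dom \<Lambda> m \<and> deg \<Lambda> n = (\<lambda>_. t)"
  shows "(\<lambda>n. m \<cdot> n) ` S \<subseteq> paths_of_deg \<Lambda> (deg \<Lambda> m + (\<lambda>_. t))"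
  using assms by (auto simp: paths_of_deg_def Comp_closed deg_Comp)

text \<open>The action preserves degrees, so both images of \<open>a\<close> are prefixes of equal
  degree of one path; they coincide and can be cancelled.\<close>

lemma act_Comp_eq:
  assumes g: "g \<in> Arr G" "Cod \<Lambda> a = Dom G g" and h: "h \<in> Arr G" "Cod \<Lambda> a = Dom G h"
    and a: "a \<in> Arr \<Lambda>" and b: "b \<in> Arr \<Lambda>" "Cod \<Lambda> b = Dom \<Lambda> a"
    and eq: "act \<phi> g (a \<cdot> b) = act \<phi> h (a \<cdot> b)"
  shows "act \<phi> g a = act \<phi> h a" "act \<phi> (res g a) b = act \<phi> (res h a) b"
proof -
  have *: "act \<phi> k a \<in> Arr \<Lambda>" "act \<phi> (res k a) b \<in> Arr \<Lambda>"
    "Dom \<Lambda> (act \<phi> k a) = Cod \<Lambda> (act \<phi> (res k a) b)" "deg \<Lambda> (act \<phi> k a) = deg \<Lambda> a"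
    if k: "k \<in> Arr G" "Cod \<Lambda> a = Dom G k" for k
    using act_path[OF k(1) a k(2)] act_path[OF res_Arr[OF k(1) a k(2)] b(1)]
      Dom_res[OF k(1) a k(2)] Cod_res[OF k(1) a k(2)] b(2) by simp_all
  have "deg \<Lambda> (act \<phi> g a) = deg \<Lambda> (act \<phi> h a)"
    by (simp only: *(4)[OF g] *(4)[OF h])
  moreover have "act \<phi> g a \<cdot> act \<phi> (res g a) b = act \<phi> h a \<cdot> act \<phi> (res h a) b"
    using eq by (simp only: act_Comp_path[OF g(1) a g(2) b] act_Comp_path[OF h(1) a h(2) b])
  ultimately show "act \<phi> g a = act \<phi> h a" "act \<phi> (res g a) b = act \<phi> (res h a) b"
    using cancel[OF *(1-3)[OF g] *(1-3)[OF h]] by blast+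
qed

text \<open>
  The paths on which \<open>g\<close> and \<open>h\<close> agree with different restrictions are asymptotically negligible:
  finitely many pairs of restrictions occur, and each pair of distinct ones is separated by some path.
\<close>

lemma measure_bad_paths:
  fixes m :: 'a and g h :: 'g
  defines "bad t \<equiv> {n \<in> paths_to \<Lambda> (Dom \<Lambda> m) \<inter> paths_of_deg \<Lambda> (\<lambda>_. t).
    act \<phi> g n = act \<phi> h n \<and> res g n \<noteq> res h n}"
  assumes m: "m \<in> Arr \<Lambda>" and g: "g \<in> Arr G" and h: "h \<in> Arr G"
    and Dg: "Dom G g = Dom \<Lambda> m" and Dh: "Dom G h = Dom \<Lambda> m"
  shows "(\<lambda>t. measure M (\<Union>a\<in>(\<lambda>n. m \<cdot> n) ` bad t. cylinder \<Lambda> a)) \<longlonglongrightarrow> 0"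
proof -
  \<comment> \<open>Common domain and codomain are part of \<open>S\<close> because
    \<open>arrow_eqI\<close>, which provides a separating path, compares parallel elements.\<close>
  define S where "S = {(a, b). a \<in> res g ` paths_to \<Lambda> (Dom G g) \<and> b \<in> res h ` paths_to \<Lambda> (Dom G h) \<and>
    a \<noteq> b \<and> Dom G a = Dom G b \<and> Cod G a = Cod G b}"
  have "finite S"
    unfolding S_def
    by (rule finite_subset[OF _ finite_cartesian_product[OF finite_res[OF g] finite_res[OF h]]]) auto
  have "\<forall>s\<in>S. \<exists>d. d \<in> Arr \<Lambda> \<and> Cod \<Lambda> d = Dom G (snd s) \<and> act \<phi> (fst s) d \<noteq> act \<phi> (snd s) d"
  proof
    fix s assume s: "s \<in> S"
    then have "fst s \<in> Arr G" "snd s \<in> Arr G"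
      using res_Arr[OF g] res_Arr[OF h] by (auto simp: paths_to_def S_def)
    moreover have "fst s \<noteq> snd s" "Dom G (fst s) = Dom G (snd s)" "Cod G (fst s) = Cod G (snd s)"
      using s by (auto simp: S_def)
    ultimately show "\<exists>d. d \<in> Arr \<Lambda> \<and> Cod \<Lambda> d = Dom G (snd s) \<and> act \<phi> (fst s) d \<noteq> act \<phi> (snd s) d"
      using arrow_eqI[of "fst s" "snd s"] by blast
  qed
  from bchoice[OF this] obtain d where d: "\<forall>s\<in>S. d s \<in> Arr \<Lambda> \<and> Cod \<Lambda> (d s) = Dom G (snd s) \<and>
    act \<phi> (fst s) (d s) \<noteq> act \<phi> (snd s) (d s)" ..
  obtain L :: nat where L: "L > 0" "\<And>s. s \<in> S \<Longrightarrow> deg \<Lambda> (d s) \<le> (\<lambda>_. L)"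
    by (rule ex_le_const[OF \<open>finite S\<close>, of "\<lambda>s. deg \<Lambda> (d s)"], rule that) auto
  have badD: "n \<in> Arr \<Lambda>" "Cod \<Lambda> n = Dom \<Lambda> m" "deg \<Lambda> n = (\<lambda>_. t)" "act \<phi> g n = act \<phi> h n" "res g n \<noteq> res h n"
    if "n \<in> bad t" for n t
    using that by (auto simp: bad_def paths_to_def paths_of_deg_def)
  show ?thesis
  proof (rule measure_decay[where b = "deg \<Lambda> m", OF _ _ _ L(1)])
    show "(\<lambda>n. m \<cdot> n) ` bad t \<subseteq> paths_of_deg \<Lambda> (deg \<Lambda> m + (\<lambda>_. t))" for t
      using m badD by (intro cylinder_family_subset) auto
  next
    fix s t a assume st: "s \<le> (t :: nat)" and "a \<in> (\<lambda>n. m \<cdot> n) ` bad t"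
    then obtain n where n: "n \<in> bad t" "a = m \<cdot> n" by blast
    note N = badD[OF n(1)]
    have "deg \<Lambda> n = (\<lambda>_. s) + (\<lambda>_. t - s)" using N st by (simp add: fun_eq_iff)
    then obtain n1 n2 where n12: "n1 \<in> Arr \<Lambda>" "n2 \<in> Arr \<Lambda>" "Dom \<Lambda> n1 = Cod \<Lambda> n2" "n = n1 \<cdot> n2"
      "deg \<Lambda> n1 = (\<lambda>_. s)" using factorise[OF N(1)] by metis
    have C1: "Cod \<Lambda> n1 = Dom G g" "Cod \<Lambda> n1 = Dom G h" using N n12 Dg Dh by (auto simp: Cod_Comp)
    have "act \<phi> g n1 = act \<phi> h n1"
      using act_Comp_eq(1)[OF g C1(1) h C1(2) n12(1,2)] n12(3,4) N(4) by simp
    \<comment> \<open>Equal restrictions at \<open>n1\<close> would remain equal at its extension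
      \<open>n\<close>.\<close>
    moreover have "res g n1 \<noteq> res h n1"
      using N(5) res_Comp[OF g n12(1) C1(1) n12(2)] res_Comp[OF h n12(1) C1(2) n12(2)] n12 by auto
    ultimately have "n1 \<in> bad s"
      using n12 C1 Dg by (simp add: bad_def paths_to_def paths_of_deg_def)
    moreover have "a \<in> extensions \<Lambda> (m \<cdot> n1)"
      using extensionsI[of "m \<cdot> n1" n2] n12 C1 Dg m n(2) by (simp add: Comp_closed Dom_Comp Comp_assoc)
    ultimately show "\<exists>c\<in>(\<lambda>n. m \<cdot> n) ` bad s. a \<in> extensions \<Lambda> c" by blast
  next
    fix t c assume "c \<in> (\<lambda>n. m \<cdot> n) ` bad t"
    then obtain n where n: "n \<in> bad t" "c = m \<cdot> n" by blast
    note N = badD[OF n(1)]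
    have C: "Cod \<Lambda> n = Dom G g" "Cod \<Lambda> n = Dom G h" using N Dg Dh by auto
    note rg = res_Arr[OF g N(1) C(1)] Dom_res[OF g N(1) C(1)] Cod_res[OF g N(1) C(1)]
    note rh = res_Arr[OF h N(1) C(2)] Dom_res[OF h N(1) C(2)] Cod_res[OF h N(1) C(2)]
    \<comment> \<open>The codomains of the two restrictions agree because \<open>g\<close> and
      \<open>h\<close> send \<open>n\<close> to the same path.\<close>
    have s: "(res g n, res h n) \<in> S"
      using N C rg rh by (auto simp: paths_to_def S_def)
    let ?d = "d (res g n, res h n)"
    have D: "?d \<in> Arr \<Lambda>" "Cod \<Lambda> ?d = Dom \<Lambda> n" "act \<phi> (res g n) ?d \<noteq> act \<phi> (res h n) ?d"
      using bspec[OF d s] rh by auto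
    \<comment> \<open>The separating path is padded to the common degree. The padding still
      separates, since agreement on it would pass to its prefix.\<close>
    obtain e where e: "e \<in> Arr \<Lambda>" "deg \<Lambda> e = (\<lambda>_. L)" "e \<in> extensions \<Lambda> ?d"
      using ex_extension[OF D(1) L(2)[OF s]] by blast
    obtain f where f: "f \<in> Arr \<Lambda>" "Dom \<Lambda> ?d = Cod \<Lambda> f" "e = ?d \<cdot> f"
      using e(3) by (rule extensionsE)
    have Ce: "Cod \<Lambda> e = Dom \<Lambda> n" using f D by (simp add: Cod_Comp)
    have "n \<cdot> e \<notin> bad (t + L)"
    proof
      assume "n \<cdot> e \<in> bad (t + L)"
      from badD(4)[OF this] have "act \<phi> (res g n) e = act \<phi> (res h n) e"
        by (rule act_Comp_eq(2)[OF g C(1) h C(2) N(1) e(1) Ce])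
      then have "act \<phi> (res g n) ?d = act \<phi> (res h n) ?d"
        using act_Comp_eq(1)[OF rg(1) _ rh(1) _ D(1) f(1)] f D(2) rg(2) rh(2) by simp
      then show False using D(3) by blast
    qed
    have ce: "c \<cdot> e = m \<cdot> (n \<cdot> e)" using n(2) m N(1,2) e(1) Ce by (simp add: Comp_assoc)
    have ne: "n \<cdot> e \<in> Arr \<Lambda>" "Cod \<Lambda> (n \<cdot> e) = Dom \<Lambda> m"
      using N(1,2) e(1) Ce by (simp_all add: Comp_closed Cod_Comp)
    have "c \<cdot> e \<notin> (\<lambda>n. m \<cdot> n) ` bad (t + L)"
    proof
      assume "c \<cdot> e \<in> (\<lambda>n. m \<cdot> n) ` bad (t + L)"
      then obtain k where k: "k \<in> bad (t + L)" "c \<cdot> e = m \<cdot> k" by (rule imageE)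
      have "n \<cdot> e = k"
        by (rule left_cancel[OF m ne badD(1,2)[OF k(1)]]) (use ce k(2) in simp)
      with k(1) \<open>n \<cdot> e \<notin> bad (t + L)\<close> show False by simp
    qed
    then show "\<exists>d\<in>Arr \<Lambda>. deg \<Lambda> d = (\<lambda>_. L) \<and> Cod \<Lambda> d = Dom \<Lambda> c \<and> c \<cdot> d \<notin> (\<lambda>n. m \<cdot> n) ` bad (t + L)"
      using e Ce n N m by (intro bexI[of _ e]) (auto simp: Dom_Comp)
  qed
qed

text \<open>The agreement set \<open>?Z\<close> lies between \<open>A t\<close>, where agreement is
  certified by equal restrictions, and \<open>A t \<union> B t\<close>, and \<open>B t\<close> is
  asymptotically null. Up to the factor \<open>wt (deg \<Lambda> m)\<close>, the expression under
  the limit is the measure of \<open>A t\<close>.\<close>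

lemma measure_eq_set:
  assumes m: "m \<in> Arr \<Lambda>" and g: "g \<in> Arr G" and h: "h \<in> Arr G"
    and Dg: "Dom G g = Dom \<Lambda> m" and Dh: "Dom G h = Dom \<Lambda> m"
  shows "(\<lambda>t. wt (\<lambda>_. t) * (\<Sum>v\<in>Obj \<Lambda>. real (card {n \<in> paths_to \<Lambda> (Dom \<Lambda> m) \<inter> paths_of_deg \<Lambda> (\<lambda>_. t) \<inter>
      paths_from \<Lambda> v. act \<phi> g n = act \<phi> h n \<and> res g n = res h n}) * \<xi> v))
    \<longlonglongrightarrow> measure M {x \<in> cylinder \<Lambda> m. iact g (shift (deg \<Lambda> m) x) = iact h (shift (deg \<Lambda> m) x)} / wt (deg \<Lambda> m)"
    (is "?c \<longlonglongrightarrow> measure M ?Z / _")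
proof -
  interpret finite_measure M by (rule finite_measure_M)
  define P where "P t = paths_to \<Lambda> (Dom \<Lambda> m) \<inter> paths_of_deg \<Lambda> (\<lambda>_. t)" for t :: nat
  define good where "good t = {n \<in> P t. act \<phi> g n = act \<phi> h n \<and> res g n = res h n}" for t
  define bad where "bad t = {n \<in> P t. act \<phi> g n = act \<phi> h n \<and> res g n \<noteq> res h n}" for t
  define A where "A t = (\<Union>a\<in>(\<lambda>n. m \<cdot> n) ` good t. cylinder \<Lambda> a)" for t
  define B where "B t = (\<Union>a\<in>(\<lambda>n. m \<cdot> n) ` bad t. cylinder \<Lambda> a)" for t
  have PD: "n \<in> Arr \<Lambda>" "Cod \<Lambda> n = Dom \<Lambda> m" "deg \<Lambda> n = (\<lambda>_. t)" if "n \<in> P t" for n t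
    using that by (auto simp: P_def paths_to_def paths_of_deg_def)
  have sub: "(\<lambda>n. m \<cdot> n) ` S \<subseteq> paths_of_deg \<Lambda> (deg \<Lambda> m + (\<lambda>_. t))" if "S \<subseteq> P t" for S t
    using m PD that by (intro cylinder_family_subset) auto
  have subG: "good t \<subseteq> P t" and subB: "bad t \<subseteq> P t" for t by (auto simp: good_def bad_def)
  have AS: "A t \<in> sets M" for t
    unfolding A_def by (rule union_cylinder_sets[OF sub[OF subG]])
  have BS: "B t \<in> sets M" for t
    unfolding B_def by (rule union_cylinder_sets[OF sub[OF subB]])
  have mem: "x \<in> (\<Union>a\<in>(\<lambda>n. m \<cdot> n) ` S. cylinder \<Lambda> a) \<longleftrightarrow>
      x \<in> cylinder \<Lambda> m \<and> shift (deg \<Lambda> m) x (0, \<lambda>_. t) \<in> S" if S: "S \<subseteq> P t" for x S t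
  proof
    assume "x \<in> (\<Union>a\<in>(\<lambda>n. m \<cdot> n) ` S. cylinder \<Lambda> a)"
    then obtain n where n: "n \<in> S" "x \<in> cylinder \<Lambda> (m \<cdot> n)" by blast
    have N: "n \<in> Arr \<Lambda>" "Cod \<Lambda> n = Dom \<Lambda> m" "deg \<Lambda> n = (\<lambda>_. t)" using PD n S by auto
    have x: "x \<in> cylinder \<Lambda> m" using cylinder_Comp[OF m N(1)] N n by auto
    then have xi: "x \<in> inf_paths \<Lambda>" "x (0, deg \<Lambda> m) = m" using cylinder_eq[OF m] by auto
    have "x (0, deg \<Lambda> m + (\<lambda>_. t)) = m \<cdot> n"
      using n(2) cylinder_eq[OF Comp_closed[OF m N(1)]] N m by (simp add: deg_Comp)
    then have "m \<cdot> shift (deg \<Lambda> m) x (0, \<lambda>_. t) = m \<cdot> n"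
      using inf_path_0_add[OF xi(1)] xi(2) by simp
    then have "shift (deg \<Lambda> m) x (0, \<lambda>_. t) = n"
      by (rule left_cancel[OF m inf_paths_to_0[OF concat_inf_eqI(1)[OF xi]] N(1,2)])
    then show "x \<in> cylinder \<Lambda> m \<and> shift (deg \<Lambda> m) x (0, \<lambda>_. t) \<in> S" using x n by simp
  next
    assume x: "x \<in> cylinder \<Lambda> m \<and> shift (deg \<Lambda> m) x (0, \<lambda>_. t) \<in> S"
    then have xi: "x \<in> inf_paths \<Lambda>" "x (0, deg \<Lambda> m) = m" using cylinder_eq[OF m] by auto
    let ?n = "shift (deg \<Lambda> m) x (0, \<lambda>_. t)"
    have N: "?n \<in> Arr \<Lambda>" "Cod \<Lambda> ?n = Dom \<Lambda> m" "deg \<Lambda> ?n = (\<lambda>_. t)" using PD x S by auto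
    have "x \<in> cylinder \<Lambda> (m \<cdot> ?n)"
      using cylinder_eq[OF Comp_closed[OF m N(1)]] inf_path_0_add[OF xi(1), of "deg \<Lambda> m" "\<lambda>_. t"] xi N m
      by (simp add: deg_Comp)
    then show "x \<in> (\<Union>a\<in>(\<lambda>n. m \<cdot> n) ` S. cylinder \<Lambda> a)" using x by blast
  qed
  have shiftm: "shift (deg \<Lambda> m) x \<in> inf_paths_to \<Lambda> (Dom \<Lambda> m)" if "x \<in> cylinder \<Lambda> m" for x
    using that concat_inf_eqI(1)[of x m] cylinder_eq[OF m] by simp
  have shP: "shift (deg \<Lambda> m) x (0, \<lambda>_. t) \<in> P t" if "x \<in> cylinder \<Lambda> m" for x t
    using inf_paths_to_0[OF shiftm[OF that]] shiftm[OF that]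
    by (simp add: P_def paths_to_def paths_of_deg_def inf_paths_to_def inf_path_0_deg)
  have AZ: "A t \<subseteq> ?Z" for t
  proof
    fix x assume "x \<in> A t"
    then have x: "x \<in> cylinder \<Lambda> m" "shift (deg \<Lambda> m) x (0, \<lambda>_. t) \<in> good t"
      using mem[OF subG] by (auto simp: A_def)
    let ?y = "shift (deg \<Lambda> m) x" and ?n = "shift (deg \<Lambda> m) x (0, \<lambda>_. t)"
    have yi: "?y \<in> inf_paths \<Lambda>" using shiftm[OF x(1)] by (simp add: inf_paths_to_def)
    have N: "?n \<in> Arr \<Lambda>" "Cod \<Lambda> ?n = Dom \<Lambda> m" "deg \<Lambda> ?n = (\<lambda>_. t)" using PD[OF shP[OF x(1), of t]] by auto
    define w where "w = shift (\<lambda>_. t) ?y"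
    have w: "w \<in> inf_paths_to \<Lambda> (Dom \<Lambda> ?n)" "concat_inf \<Lambda> ?n w = ?y"
      using concat_inf_eqI[OF yi, of ?n] N by (simp_all add: w_def)
    \<comment> \<open>With equal images and equal restrictions at \<open>?n\<close>, the two
      elements agree on every infinite path through \<open>?n\<close>.\<close>
    have "iact g ?y = iact h ?y"
      using iact_concat[OF g N(1) _ w(1)] iact_concat[OF h N(1) _ w(1)] w(2) N Dg Dh x(2)
      by (simp add: good_def)
    then show "x \<in> ?Z" using x by simp
  qed
  have ZAB: "?Z \<subseteq> A t \<union> B t" for t
  proof
    fix x assume x: "x \<in> ?Z"
    let ?n = "shift (deg \<Lambda> m) x (0, \<lambda>_. t)"
    have "act \<phi> g ?n = act \<phi> h ?n"
      using x iact_0[OF g, of "shift (deg \<Lambda> m) x" "\<lambda>_. t"] iact_0[OF h, of "shift (deg \<Lambda> m) x" "\<lambda>_. t"]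
        shiftm[of x] Dg Dh by simp
    then have "?n \<in> good t \<union> bad t"
      using shP x by (auto simp: good_def bad_def)
    moreover have "x \<in> A t \<longleftrightarrow> ?n \<in> good t" "x \<in> B t \<longleftrightarrow> ?n \<in> bad t"
      using x mem[OF subG, of x] mem[OF subB, of x] by (simp_all add: A_def B_def)
    ultimately show "x \<in> A t \<union> B t" by blast
  qed
  \<comment> \<open>This yields measurability: a point of all the unions has equal images on every
    diagonal segment, which is equality of the infinite images.\<close>
  have "?Z = (\<Inter>t. A t \<union> B t)"
  proof (intro equalityI subsetI)
    fix x assume x: "x \<in> (\<Inter>t. A t \<union> B t)"
    then have "x \<in> cylinder \<Lambda> m \<and> shift (deg \<Lambda> m) x (0, \<lambda>_. t) \<in> good t \<union> bad t" for t
      using mem[OF subG, of x t] mem[OF subB, of x t] by (auto simp: A_def B_def)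
    then have xm: "x \<in> cylinder \<Lambda> m"
      and eq: "\<And>t. act \<phi> g (shift (deg \<Lambda> m) x (0, \<lambda>_. t)) = act \<phi> h (shift (deg \<Lambda> m) x (0, \<lambda>_. t))"
      by (auto simp: good_def bad_def)
    have "iact g (shift (deg \<Lambda> m) x) = iact h (shift (deg \<Lambda> m) x)"
      using shiftm[OF xm] Dg Dh eq by (intro inf_path_eqI_diag) (simp_all add: iact_path g h iact_0)
    then show "x \<in> ?Z" using xm by simp
  qed (use ZAB in blast)
  moreover have "(\<Inter>t. A t \<union> B t) \<in> sets M" using AS BS by (intro sets.countable_INT) auto
  ultimately have ZS: "?Z \<in> sets M" by simp
  have mA: "measure M (A t) = wt (deg \<Lambda> m) * ?c t" for t
  proof -
    have inj: "inj_on (\<lambda>n. m \<cdot> n) (good t)"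
    proof (rule inj_onI)
      fix n n' assume "n \<in> good t" "n' \<in> good t" and eq: "m \<cdot> n = m \<cdot> n'"
      then have "n \<in> P t" "n' \<in> P t" using subG by auto
      then show "n = n'" using left_cancel[OF m PD(1,2) PD(1,2) eq] by blast
    qed
    have Dmn: "Dom \<Lambda> (m \<cdot> n) = Dom \<Lambda> n" if "n \<in> good t" for n
      using PD[of n t] subG[of t] that m by (auto simp: Dom_Comp)
    have fin: "finite (good t)"
      by (rule finite_subset[OF _ finite_paths_of_deg[of "\<lambda>_. t"]]) (auto simp: good_def P_def)
    have "measure M (A t) = wt (deg \<Lambda> m + (\<lambda>_. t)) * (\<Sum>a\<in>(\<lambda>n. m \<cdot> n) ` good t. \<xi> (Dom \<Lambda> a))"
      unfolding A_def by (rule measure_union_cylinder[OF sub[OF subG]])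
    also have "(\<Sum>a\<in>(\<lambda>n. m \<cdot> n) ` good t. \<xi> (Dom \<Lambda> a)) = (\<Sum>n\<in>good t. \<xi> (Dom \<Lambda> n))"
      by (subst sum.reindex[OF inj]) (simp add: Dmn)
    \<comment> \<open>Sorting the paths by source vertex produces the counts that appear in
      \<open>c_coeff\<close>.\<close>
    also have "\<dots> = (\<Sum>v\<in>Obj \<Lambda>. \<Sum>n\<in>{n \<in> good t. Dom \<Lambda> n = v}. \<xi> (Dom \<Lambda> n))"
      using fin finite_Obj PD(1)[OF subsetD[OF subG[of t]]] by (intro sum.group[symmetric]) (auto intro: Dom_closed)
    also have "\<dots> = (\<Sum>v\<in>Obj \<Lambda>. real (card {n \<in> paths_to \<Lambda> (Dom \<Lambda> m) \<inter> paths_of_deg \<Lambda> (\<lambda>_. t) \<inter>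
      paths_from \<Lambda> v. act \<phi> g n = act \<phi> h n \<and> res g n = res h n}) * \<xi> v)"
    proof (rule sum.cong[OF refl])
      fix v
      have eq: "{n \<in> good t. Dom \<Lambda> n = v} = {n \<in> paths_to \<Lambda> (Dom \<Lambda> m) \<inter> paths_of_deg \<Lambda> (\<lambda>_. t) \<inter>
        paths_from \<Lambda> v. act \<phi> g n = act \<phi> h n \<and> res g n = res h n}"
        by (auto simp: good_def P_def paths_from_def paths_to_def)
      have "(\<Sum>n\<in>{n \<in> good t. Dom \<Lambda> n = v}. \<xi> (Dom \<Lambda> n)) = (\<Sum>n\<in>{n \<in> good t. Dom \<Lambda> n = v}. \<xi> v)"
        by (rule sum.cong) auto
      also have "\<dots> = real (card {n \<in> good t. Dom \<Lambda> n = v}) * \<xi> v" by simp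
      finally show "(\<Sum>n\<in>{n \<in> good t. Dom \<Lambda> n = v}. \<xi> (Dom \<Lambda> n)) =
        real (card {n \<in> paths_to \<Lambda> (Dom \<Lambda> m) \<inter> paths_of_deg \<Lambda> (\<lambda>_. t) \<inter>
        paths_from \<Lambda> v. act \<phi> g n = act \<phi> h n \<and> res g n = res h n}) * \<xi> v"
        unfolding eq .
    qed
    finally show ?thesis
      unfolding wt_add[of "deg \<Lambda> m" "\<lambda>_. t"] by (simp only: mult.assoc)
  qed
  have limB: "(\<lambda>t. measure M (B t)) \<longlonglongrightarrow> 0"
    using measure_bad_paths[OF m g h Dg Dh] unfolding B_def bad_def P_def .
  have "(\<lambda>t. measure M ?Z - measure M (A t)) \<longlonglongrightarrow> 0"
  proof (rule tendsto_sandwich[OF _ _ tendsto_const limB])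
    show "\<forall>\<^sub>F t in sequentially. 0 \<le> measure M ?Z - measure M (A t)"
      using finite_measure_mono[OF AZ ZS] by simp
    have "measure M ?Z \<le> measure M (A t) + measure M (B t)" for t
      using finite_measure_mono[OF ZAB[of t]] measure_Un_le[OF AS BS, of t t] AS BS
      by (meson order_trans sets.Un)
    then show "\<forall>\<^sub>F t in sequentially. measure M ?Z - measure M (A t) \<le> measure M (B t)"
      by (simp add: algebra_simps)
  qed
  then have "(\<lambda>t. measure M ?Z - (measure M ?Z - measure M (A t))) \<longlonglongrightarrow> measure M ?Z - 0"
    by (intro tendsto_diff tendsto_const)
  then have "(\<lambda>t. measure M (A t)) \<longlonglongrightarrow> measure M ?Z" by simp
  then have "(\<lambda>t. measure M (A t) / wt (deg \<Lambda> m)) \<longlonglongrightarrow> measure M ?Z / wt (deg \<Lambda> m)"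
    using wt_pos[of "deg \<Lambda> m"] by (intro tendsto_divide tendsto_const) auto
  moreover have "measure M (A t) / wt (deg \<Lambda> m) = ?c t" for t
    using wt_pos[of "deg \<Lambda> m"] unfolding mA by simp
  ultimately show ?thesis by simp
qed

text \<open>Writing \<open>h\<close> for \<open>h_elt G \<Lambda> \<phi> p q l\<close>: since
  \<open>l\<close> followed by \<open>h\<close> applied to \<open>y\<close> equals \<open>m\<close>
  followed by \<open>y\<close> for all \<open>y\<close>, cancelling \<open>l\<close> turns the
  defining equation into equality of the images of \<open>y\<close> under \<open>g\<close> and
  \<open>h\<close>. Proved convergence then evaluates the \<open>lim\<close> in
  \<open>c_coeff\<close>.\<close>

lemma measure_triple_cylinder_theta:
  assumes l: "l \<in> Arr \<Lambda>" and m: "m \<in> Arr \<Lambda>" and g: "g \<in> Arr G" "Dom \<Lambda> l = Cod G g" "Dom \<Lambda> m = Dom G g"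
    and mh: "theta_h_pair (deg \<Lambda> m) l m (h_elt G \<Lambda> \<phi> p q l)"
  shows "measure M (triple_cylinder G \<Lambda> \<phi> l g m) = wt (deg \<Lambda> m) * c_coeff G \<Lambda> \<phi> \<xi> p q l g"
proof -
  let ?h = "h_elt G \<Lambda> \<phi> p q l" and ?s = "shift (deg \<Lambda> m) :: ('a, 'k) inf_path \<Rightarrow> ('a, 'k) inf_path"
  have h: "?h \<in> Arr G" "Dom G ?h = Dom \<Lambda> m" "Cod G ?h = Dom \<Lambda> l" using mh by auto
  let ?Z = "{x \<in> cylinder \<Lambda> m. iact g (?s x) = iact ?h (?s x)}"
  have "concat_inf \<Lambda> l (iact g (?s x)) = x \<longleftrightarrow> iact g (?s x) = iact ?h (?s x)"
    if x: "x \<in> inf_paths \<Lambda>" "x (0, deg \<Lambda> m) = m" for x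
  proof -
    have sx: "?s x \<in> inf_paths_to \<Lambda> (Dom \<Lambda> m)" "concat_inf \<Lambda> m (?s x) = x" using concat_inf_eqI[OF x] by auto
    then have "concat_inf \<Lambda> l (iact ?h (?s x)) = x" using mh by auto
    then show ?thesis
      using concat_inf_inject(2)[OF l _ l _ refl, of "iact g (?s x)" "iact ?h (?s x)"]
        iact_range[OF g(1), of "?s x"] iact_range[OF h(1), of "?s x"] sx g h by auto
  qed
  then have "triple_cylinder G \<Lambda> \<phi> l g m = ?Z"
    using triple_cylinder_eq[OF l m g(3)] cylinder_eq[OF m] by auto
  moreover have "c_coeff G \<Lambda> \<phi> \<xi> p q l g = measure M ?Z / wt (deg \<Lambda> m)"
    unfolding c_coeff_def g(3)[symmetric]
    by (rule limI[OF measure_eq_set[OF m g(1) h(1) g(3)[symmetric] h(2)]])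
  ultimately show ?thesis using wt_pos[of "deg \<Lambda> m"] by simp
qed

text \<open>
  If \<open>x = l (g y) = m y\<close> and \<open>n\<close> is a prefix of \<open>y = n z\<close>, then \<open>\<sigma>\<^sup>p z = \<sigma>\<^sup>q (g|\<^sub>n z)\<close>; as \<open>p - q\<close>
  is not a period, each of the finitely many restrictions \<open>g|\<^sub>n\<close> has a path along which this fails.
\<close>

lemma measure_triple_cylinder_not_Per:
  assumes l: "l \<in> Arr \<Lambda>" and m: "m \<in> Arr \<Lambda>" and g: "g \<in> Arr G" "Dom \<Lambda> l = Cod G g" "Dom \<Lambda> m = Dom G g"
    and per: "deg_diff (deg \<Lambda> l) (deg \<Lambda> m) \<notin> Per G \<Lambda> \<phi>"
  shows "measure M (triple_cylinder G \<Lambda> \<phi> l g m) = 0"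
proof -
  interpret finite_measure M by (rule finite_measure_M)
  let ?p = "deg \<Lambda> l" and ?q = "deg \<Lambda> m"
  let ?S = "res g ` paths_to \<Lambda> (Dom G g)"
  have SA: "a \<in> Arr G" if "a \<in> ?S" for a using that res_Arr[OF g(1)] by (auto simp: paths_to_def)
  \<comment> \<open>An element satisfying the shift equation throughout its domain would make the
    difference a period. So each restriction fails it at some infinite path \<open>fst zn\<close>,
    and the failure shows in the initial segment of degree \<open>snd zn\<close>.\<close>
  have "\<forall>a\<in>?S. \<exists>zn. fst zn \<in> inf_paths_to \<Lambda> (Dom G a) \<and>
      shift ?p (fst zn) (0, snd zn) \<noteq> shift ?q (iact a (fst zn)) (0, snd zn)"
  proof
    fix a assume "a \<in> ?S"
    then have a: "a \<in> Arr G" using SA by blast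
    then obtain z where z: "z \<in> inf_paths_to \<Lambda> (Dom G a)" "shift ?p z \<noteq> shift ?q (iact a z)"
      using per unfolding Per_def by blast
    have "shift ?p z \<in> inf_paths \<Lambda>" "shift ?q (iact a z) \<in> inf_paths \<Lambda>"
      using z(1) iact_path[OF a z(1)] by (auto simp: inf_paths_to_def intro: shift_inf_path)
    then obtain n where "shift ?p z (0, n) \<noteq> shift ?q (iact a z) (0, n)"
      using z(2) inf_path_eqI by blast
    then show "\<exists>zn. fst zn \<in> inf_paths_to \<Lambda> (Dom G a) \<and>
      shift ?p (fst zn) (0, snd zn) \<noteq> shift ?q (iact a (fst zn)) (0, snd zn)"
      using z by (intro exI[of _ "(z, n)"]) simp
  qed
  from bchoice[OF this] obtain zn where zn: "\<forall>a\<in>?S. fst (zn a) \<in> inf_paths_to \<Lambda> (Dom G a) \<and>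
      shift ?p (fst (zn a)) (0, snd (zn a)) \<noteq> shift ?q (iact a (fst (zn a))) (0, snd (zn a))" ..
  \<comment> \<open>Segments seen after a shift by \<open>?p\<close> or \<open>?q\<close> reach that
    much further into the unshifted path; \<open>L\<close> leaves room for both.\<close>
  obtain L :: nat where L: "L > 0" "\<And>a. a \<in> ?S \<Longrightarrow> snd (zn a) + (?p + ?q) \<le> (\<lambda>_. L)"
    by (rule ex_le_const[OF finite_res[OF g(1)], of "\<lambda>a. snd (zn a) + (?p + ?q)"], rule that) auto
  define Y where "Y = {y \<in> inf_paths_to \<Lambda> (Dom G g). concat_inf \<Lambda> l (iact g y) = concat_inf \<Lambda> m y}"
  \<comment> \<open>Built from prefixes of actual solutions, so that prefix closure is immediate and
    each member comes with an infinite solution through it.\<close>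
  define E where "E t = (\<lambda>n. m \<cdot> n) ` (\<lambda>y. y (0, \<lambda>_. t)) ` Y" for t :: nat
  have YD: "y \<in> inf_paths_to \<Lambda> (Dom G g)" "y \<in> inf_paths_to \<Lambda> (Dom \<Lambda> m)" "y \<in> inf_paths \<Lambda>"
    "concat_inf \<Lambda> l (iact g y) = concat_inf \<Lambda> m y" if "y \<in> Y" for y
    using that g by (auto simp: Y_def inf_paths_to_def)
  have y0: "y (0, n) \<in> Arr \<Lambda>" "Cod \<Lambda> (y (0, n)) = Dom \<Lambda> m" "deg \<Lambda> (y (0, n)) = n" if "y \<in> Y" for y n
    using inf_paths_to_0[OF YD(2)[OF that]] YD(3)[OF that] by (auto simp: inf_path_0_deg)
  have E: "E t \<subseteq> paths_of_deg \<Lambda> (?q + (\<lambda>_. t))" for t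
    unfolding E_def using m y0 by (intro cylinder_family_subset) auto
  have "(\<lambda>t. measure M (\<Union>a\<in>E t. cylinder \<Lambda> a)) \<longlonglongrightarrow> 0"
  proof (rule measure_decay[where b = ?q, OF E _ _ L(1)])
    fix s t a assume st: "s \<le> (t :: nat)" and "a \<in> E t"
    then obtain y where y: "y \<in> Y" "a = m \<cdot> y (0, \<lambda>_. t)" by (auto simp: E_def)
    have "y (0, \<lambda>_. t) \<in> extensions \<Lambda> (y (0, \<lambda>_. s))"
      using inf_path_extensions[OF YD(3)[OF y(1)]] st by (simp add: le_fun_def)
    then obtain b where b: "b \<in> Arr \<Lambda>" "Dom \<Lambda> (y (0, \<lambda>_. s)) = Cod \<Lambda> b" "y (0, \<lambda>_. t) = y (0, \<lambda>_. s) \<cdot> b"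
      by (rule extensionsE)
    have "a \<in> extensions \<Lambda> (m \<cdot> y (0, \<lambda>_. s))"
      using extensionsI[of "m \<cdot> y (0, \<lambda>_. s)" b] b y0[OF y(1)] m y(2)
      by (simp add: Comp_closed Dom_Comp Comp_assoc)
    then show "\<exists>c\<in>E s. a \<in> extensions \<Lambda> c" using y by (auto simp: E_def)
  next
    fix t c assume "c \<in> E t"
    then obtain y where y: "y \<in> Y" "c = m \<cdot> y (0, \<lambda>_. t)" by (auto simp: E_def)
    let ?n = "y (0, \<lambda>_. t)"
    note N = y0[OF y(1), of "\<lambda>_. t"]
    have C: "Cod \<Lambda> ?n = Dom G g" using N g by simp
    let ?a = "res g ?n"
    have aS: "?a \<in> ?S" using N C by (auto simp: paths_to_def)
    note a = res_Arr[OF g(1) N(1) C] Dom_res[OF g(1) N(1) C] Cod_res[OF g(1) N(1) C]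
    define z n where "z = fst (zn ?a)" and "n = snd (zn ?a)"
    have z: "z \<in> inf_paths_to \<Lambda> (Dom G ?a)" "shift ?p z (0, n) \<noteq> shift ?q (iact ?a z) (0, n)"
      using bspec[OF zn aS] by (auto simp: z_def n_def)
    have zi: "z \<in> inf_paths \<Lambda>" using z(1) by (simp add: inf_paths_to_def)
    have "n i + ?p i \<le> L \<and> n i + ?q i \<le> L" for i
      using le_funD[OF L(2)[OF aS], of i] by (simp add: n_def)
    then have nL: "n + ?p \<le> (\<lambda>_. L)" "n + ?q \<le> (\<lambda>_. L)"
      by (simp_all add: le_fun_def)
    \<comment> \<open>Long enough that every infinite path beginning with \<open>d\<close> fails the
      shift equation in the same way as \<open>z\<close>.\<close>
    define d where "d = z (0, \<lambda>_. L)"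
    have d: "d \<in> Arr \<Lambda>" "Cod \<Lambda> d = Dom \<Lambda> ?n" "deg \<Lambda> d = (\<lambda>_. L)"
      using inf_paths_to_0[OF z(1)] a zi by (auto simp: d_def inf_path_0_deg)
    have "c \<cdot> d \<notin> E (t + L)"
    proof
      assume "c \<cdot> d \<in> E (t + L)"
      then obtain u where u: "u \<in> Y" "c \<cdot> d = m \<cdot> u (0, \<lambda>_. t + L)" by (auto simp: E_def)
      have "m \<cdot> (?n \<cdot> d) = m \<cdot> u (0, \<lambda>_. t + L)" using u(2) y(2) m N d by (simp add: Comp_assoc)
      then have nd: "?n \<cdot> d = u (0, \<lambda>_. t + L)"
        using N d by (intro left_cancel[OF m _ _ y0(1,2)[OF u(1)]]) (simp_all add: Comp_closed Cod_Comp)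
      have un: "u (0, \<lambda>_. t) = ?n"
        using inf_path_prefix_eq[OF YD(3)[OF u(1)], of "\<lambda>_. t + L" ?n] extensionsI[OF N(1) d(1)] nd N d
        by (simp add: le_fun_def)
      define w where "w = shift (\<lambda>_. t) u"
      have w: "w \<in> inf_paths_to \<Lambda> (Dom \<Lambda> ?n)" "concat_inf \<Lambda> ?n w = u"
        using concat_inf_eqI[OF YD(3)[OF u(1)], of ?n] un N by (simp_all add: w_def)
      have wi: "w \<in> inf_paths \<Lambda>" and wa: "w \<in> inf_paths_to \<Lambda> (Dom G ?a)"
        using w a by (auto simp: inf_paths_to_def)
      have tL: "(\<lambda>_. t + L) = (\<lambda>_. t) + (\<lambda>_. L)" by (simp add: fun_eq_iff)
      have "?n \<cdot> w (0, \<lambda>_. L) = ?n \<cdot> d"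
        using inf_path_0_add[OF YD(3)[OF u(1)], of "\<lambda>_. t" "\<lambda>_. L"] nd un unfolding tL w_def by simp
      then have "w (0, \<lambda>_. L) = d"
        by (rule left_cancel[OF N(1) inf_paths_to_0[OF w(1)] d(1,2)])
      then have wd: "w (0, \<lambda>_. L) = z (0, \<lambda>_. L)" by (simp add: d_def)
      have gu: "iact g u = concat_inf \<Lambda> (act \<phi> g ?n) (iact ?a w)"
        using iact_concat[OF g(1) N(1) C w(1)] w(2) by simp
      have aw: "iact ?a w \<in> inf_paths_to \<Lambda> (Dom \<Lambda> (act \<phi> g ?n))"
        using iact_range[OF a(1) wa] a by simp
      note gn = act_path[OF g(1) N(1) C]
      have gul: "iact g u \<in> inf_paths_to \<Lambda> (Dom \<Lambda> l)" using iact_range[OF g(1) YD(1)[OF u(1)]] g by simp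
      \<comment> \<open>Both sides of the equation for \<open>u\<close> are shifted by the same
        total. On this side \<open>?p\<close> removes \<open>l\<close> and \<open>t\<close> removes
        the image of \<open>?n\<close>; on the other \<open>?q\<close> removes \<open>m\<close> and
        \<open>t\<close> removes \<open>?n\<close>.\<close>
      have "shift (?p + ((\<lambda>_. t) + ?q)) (concat_inf \<Lambda> l (iact g u)) = shift ((\<lambda>_. t) + ?q) (iact g u)"
        by (rule shift_add_concat_inf[OF l gul])
      also have "\<dots> = shift ?q (iact ?a w)"
        using shift_add_concat_inf[OF gn(1) aw, of ?q] gn N unfolding gu by simp
      finally have 1: "shift (?p + ((\<lambda>_. t) + ?q)) (concat_inf \<Lambda> l (iact g u)) = shift ?q (iact ?a w)" .
      have "shift (?q + ((\<lambda>_. t) + ?p)) (concat_inf \<Lambda> m u) = shift ((\<lambda>_. t) + ?p) u"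
        by (rule shift_add_concat_inf[OF m YD(2)[OF u(1)]])
      also have "\<dots> = shift ?p w"
        using shift_shift[OF YD(3)[OF u(1)], of ?p "\<lambda>_. t"] by (simp add: w_def)
      finally have 2: "shift (?q + ((\<lambda>_. t) + ?p)) (concat_inf \<Lambda> m u) = shift ?p w" .
      have "?p + ((\<lambda>_. t) + ?q) = ?q + ((\<lambda>_. t) + ?p)" by (simp add: fun_eq_iff)
      then have "shift ?p w = shift ?q (iact ?a w)" using 1 2 YD(4)[OF u(1)] by simp
      \<comment> \<open>The segments compared lie within degree \<open>L\<close>, where
        \<open>w\<close> and \<open>z\<close> coincide, so the equation valid for \<open>w\<close>
        contradicts its failure at \<open>z\<close>.\<close>
      moreover have "shift ?p w (0, n) = shift ?p z (0, n)"
        using inf_path_segment_eq[OF wi zi] inf_path_eq_mono[OF wi zi wd nL(1)] fun_le_addI(2)[of ?p n]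
        by (simp add: shift_apply)
      moreover have "shift ?q (iact ?a w) (0, n) = shift ?q (iact ?a z) (0, n)"
      proof -
        have i: "iact ?a w \<in> inf_paths \<Lambda>" "iact ?a z \<in> inf_paths \<Lambda>"
          using iact_path[OF a(1)] wa z by auto
        have "iact ?a w (0, \<lambda>_. L) = iact ?a z (0, \<lambda>_. L)"
          using iact_0[OF a(1) wa] iact_0[OF a(1) z(1)] wd by simp
        from inf_path_segment_eq[OF i inf_path_eq_mono[OF i this nL(2)] fun_le_addI(2)] show ?thesis
          by (simp only: shift_apply[OF fun_zero_le(1)] add_0_left)
      qed
      ultimately show False using z(2) by simp
    qed
    then show "\<exists>d\<in>Arr \<Lambda>. deg \<Lambda> d = (\<lambda>_. L) \<and> Cod \<Lambda> d = Dom \<Lambda> c \<and> c \<cdot> d \<notin> E (t + L)"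
      using d y(2) N m by (intro bexI[of _ d]) (auto simp: Dom_Comp)
  qed
  \<comment> \<open>Every stage covers the whole set, so its measure stays below a sequence tending
    to 0.\<close>
  moreover have "measure M (triple_cylinder G \<Lambda> \<phi> l g m) \<le> measure M (\<Union>a\<in>E t. cylinder \<Lambda> a)" for t
  proof (rule finite_measure_mono[OF _ union_cylinder_sets[OF E]])
    show "triple_cylinder G \<Lambda> \<phi> l g m \<subseteq> (\<Union>a\<in>E t. cylinder \<Lambda> a)"
    proof
      fix x assume "x \<in> triple_cylinder G \<Lambda> \<phi> l g m"
      then obtain y where y: "y \<in> Y" "x = concat_inf \<Lambda> m y"
        unfolding triple_cylinder_def Y_def by auto
      have "x (0, ?q + (\<lambda>_. t)) = m \<cdot> y (0, \<lambda>_. t)"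
        using concat_inf_0_add[OF m YD(2)[OF y(1)]] y(2) by simp
      then show "x \<in> (\<Union>a\<in>E t. cylinder \<Lambda> a)"
        unfolding union_cylinder_eq[OF E]
        using concat_inf_path[OF m YD(2)[OF y(1)]] y by (auto simp: E_def)
    qed
  qed
  ultimately have "measure M (triple_cylinder G \<Lambda> \<phi> l g m) \<le> 0"
    by (meson LIMSEQ_le_const)
  then show ?thesis using measure_nonneg by (meson order_antisym)
qed

end

theorem theorem11p6:
  fixes \<Lambda> :: "('v, 'a, 'k::finite) kgraph"
    and G :: "('v, 'g) category"
    and \<phi> :: "'g \<Rightarrow> 'v \<times> 'v \<times> ('a \<Rightarrow> 'a)"
    and \<xi> :: "'v \<Rightarrow> real"
    and M :: "('a, 'k) inf_path measure"
    and l m :: 'a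
    and g :: 'g
  assumes "strongly_connected_finite_kgraph \<Lambda>"
    and "self_similar_action G \<Lambda> \<phi>"
    and "finite_state G \<Lambda> \<phi>"
    and "perron_frobenius_eigenvector \<Lambda> \<xi>"
    and "parry_measure \<Lambda> \<xi> M"
    and "l \<in> Arr \<Lambda>" and "m \<in> Arr \<Lambda>" and "g \<in> Arr G"
    and "Dom \<Lambda> l = Cod G g" and "Dom \<Lambda> m = Dom G g"
  shows "measure M (triple_cylinder G \<Lambda> \<phi> l g m) =
    (if deg_diff (deg \<Lambda> l) (deg \<Lambda> m) \<in> Per G \<Lambda> \<phi> \<and>
        m = theta G \<Lambda> \<phi> (deg \<Lambda> l) (deg \<Lambda> m) l \<and>
        g = h_elt G \<Lambda> \<phi> (deg \<Lambda> l) (deg \<Lambda> m) l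
     then rho_power \<Lambda> (\<lambda>i. - int (deg \<Lambda> m i)) * \<xi> (Dom \<Lambda> m)
     else if deg_diff (deg \<Lambda> l) (deg \<Lambda> m) \<in> Per G \<Lambda> \<phi> \<and>
        m = theta G \<Lambda> \<phi> (deg \<Lambda> l) (deg \<Lambda> m) l \<and>
        g \<noteq> h_elt G \<Lambda> \<phi> (deg \<Lambda> l) (deg \<Lambda> m) l
     then rho_power \<Lambda> (\<lambda>i. - int (deg \<Lambda> m i)) *
        c_coeff G \<Lambda> \<phi> \<xi> (deg \<Lambda> l) (deg \<Lambda> m) l g
     else 0)"
proof -
  interpret strongly_connected_finite_kgraph \<Lambda> by fact
  interpret parry_action \<Lambda> \<xi> M G \<phi>
    by unfold_locales fact+
  note lmg = assms(6-10)
  show ?thesis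
  proof (cases "deg_diff (deg \<Lambda> l) (deg \<Lambda> m) \<in> Per G \<Lambda> \<phi>")
    case False
    then show ?thesis using measure_triple_cylinder_not_Per[OF lmg] by simp
  next
    case True
    \<comment> \<open>For a period, the \<open>THE\<close>-defined \<open>theta\<close> and
      \<open>h_elt\<close> can be replaced by their characterising property.\<close>
    note mh = theta_h_pair[OF True assms(6)]
    show ?thesis
    proof (cases "m = theta G \<Lambda> \<phi> (deg \<Lambda> l) (deg \<Lambda> m) l")
      case False
      then show ?thesis using triple_cylinder_not_theta[OF lmg mh] by simp
    next
      case theta: True
      let ?h = "h_elt G \<Lambda> \<phi> (deg \<Lambda> l) (deg \<Lambda> m) l"
      have mh': "theta_h_pair (deg \<Lambda> m) l m ?h" using mh unfolding theta[symmetric] .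
      show ?thesis
        using True theta measure_triple_cylinder_theta_h[OF assms(6,7) mh']
          measure_triple_cylinder_theta[OF lmg mh'] by auto
    qed
  qed
qed

end
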